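(* Let $B$, $G$ and $R$ be three pairwise disjoint finite sets of points in the plane such that $B\cup G$ is in general position (no three points of $B\cup G$ are collinear) and every line through a point of $B$ and a point of $G$ passes through a point of $R$. Assume that $|B|=|G|=n$, that $|R|<\frac{3}{2}n$, and that $B\cup G\cup R$ is contained in an irreducible cubic curve $c$. Then there is a subgroup $H$ of (the group of) $c$ of cardinality at most $|R|$ such that each of $B$ and $G$ is contained in a coset of $H$ (the two cosets may be different).
   Context: The plane is the real plane, with points at infinity allowed, i.e. the real projective plane $\mathbb{R}^2\cup\{\text{line at infinity}\}$. Group structure on an irreducible cubic curve $c$: the nonsingular real points of $c$ carry a natural abelian group structure, written additively, whose identity $0$ is an inflection point. In it three points of $c$ lying on a common line (counted with intersection multiplicity) have sum $0$. In particular three distinct nonsingular points $A,B,C$ of $c$ are collinear if and only if $A+B+C=0$, and if a line crosses $c$ at $A$ and is tangent to $c$ at $B$ then $A+B+B=0$. "Subgroup of $c$" and "coset" refer to this group. *)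

theory Defs
  imports
    "HOL-Analysis.Analysis"
    "HOL-Computational_Algebra.Computational_Algebra"
    "HOL-Algebra.Coset"
begin

section \<open>The real projective plane\<close>

text \<open>
  Points and lines of the plane (points at infinity included) are the one- and two-dimensional
  linear subspaces of \<open>\<real>\<^sup>3\<close>; the affine point \<open>(x, y)\<close> is the span of \<open>(x, y, 1)\<close>.
\<close>

typedef proj_point = "{L :: (real ^ 3) set. subspace L \<and> dim L = 1}"
proof -
  have "dim (span {axis 1 1 :: real ^ 3}) = 1"
    by (simp add: dim_insert dim_eq_0 axis_eq_0_iff)
  then show ?thesis
    using subspace_span by blast
qed

typedef proj_line = "{W :: (real ^ 3) set. subspace W \<and> dim W = 2}"
proof -
  have "\<exists>W :: (real ^ 3) set. subspace W \<and> W \<subseteq> span UNIV \<and> dim W = 2"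
    using choose_subspace_of_subspace[of 2 "UNIV :: (real ^ 3) set"] by auto
  then show ?thesis
    by blast
qed

definition on_line :: "proj_point \<Rightarrow> proj_line \<Rightarrow> bool" where
  "on_line P l \<longleftrightarrow> Rep_proj_point P \<subseteq> Rep_proj_line l"

definition general_position :: "proj_point set \<Rightarrow> bool" where
  "general_position S \<longleftrightarrow>
     (\<forall>P\<in>S. \<forall>Q\<in>S. \<forall>T\<in>S. P \<noteq> Q \<and> P \<noteq> T \<and> Q \<noteq> T \<longrightarrow>
        \<not> (\<exists>l. on_line P l \<and> on_line Q l \<and> on_line T l))"


section \<open>Plane cubic curves\<close>

text \<open>
  Polynomials in \<open>X, Y, Z\<close> over the reals are rendered as \<open>\<real>[X][Y][Z]\<close>, the outermost variable
  being \<open>Z\<close>.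
\<close>

type_synonym poly3 = "real poly poly poly"

definition coeff3 :: "poly3 \<Rightarrow> nat \<Rightarrow> nat \<Rightarrow> nat \<Rightarrow> real" where
  \<comment> \<open>the coefficient of \<open>X ^ i * Y ^ j * Z ^ k\<close>\<close>
  "coeff3 F i j k = coeff (coeff (coeff F k) j) i"

definition eval3 :: "poly3 \<Rightarrow> real ^ 3 \<Rightarrow> real" where
  "eval3 F v = poly (poly (poly F [:[:v $ 3:]:]) [:v $ 2:]) (v $ 1)"

definition homogeneous3 :: "nat \<Rightarrow> poly3 \<Rightarrow> bool" where
  "homogeneous3 d F \<longleftrightarrow> (\<forall>i j k. coeff3 F i j k \<noteq> 0 \<longrightarrow> i + j + k = d)"

text \<open>
  A cubic curve is given by its equation. A real ternary cubic form is irreducible over \<open>\<real>\<close> iff it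
  is irreducible over \<open>\<complex>\<close>: among the linear factors of a reducible one, an odd number (one or
  three), complex conjugation fixes one up to a scalar.
\<close>

definition irreducible_cubic :: "poly3 \<Rightarrow> bool" where
  "irreducible_cubic F \<longleftrightarrow> homogeneous3 3 F \<and> irreducible F"

definition curve_points :: "poly3 \<Rightarrow> proj_point set" where
  "curve_points F = {P. \<forall>v\<in>Rep_proj_point P. eval3 F v = 0}"

definition deriv_X :: "poly3 \<Rightarrow> poly3" where
  "deriv_X F = map_poly (map_poly pderiv) F"

definition deriv_Y :: "poly3 \<Rightarrow> poly3" where
  "deriv_Y F = map_poly pderiv F"

definition deriv_Z :: "poly3 \<Rightarrow> poly3" where
  "deriv_Z F = pderiv F"

definition nonsingular_points :: "poly3 \<Rightarrow> proj_point set" where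
  "nonsingular_points F =
     {P \<in> curve_points F. \<forall>v\<in>Rep_proj_point P. v \<noteq> 0 \<longrightarrow>
        eval3 (deriv_X F) v \<noteq> 0 \<or> eval3 (deriv_Y F) v \<noteq> 0 \<or> eval3 (deriv_Z F) v \<noteq> 0}"


section \<open>Intersection of a curve with a line\<close>

definition restrict_line :: "poly3 \<Rightarrow> real ^ 3 \<Rightarrow> real ^ 3 \<Rightarrow> real poly" where
  \<comment> \<open>the univariate polynomial \<open>F (v + t w)\<close> in \<open>t\<close>\<close>
  "restrict_line F v w =
     poly (map_poly (\<lambda>q. poly (map_poly (\<lambda>r. pcompose r [:v $ 1, w $ 1:]) q) [:v $ 2, w $ 2:]) F)
       [:v $ 3, w $ 3:]"

text \<open>
  The intersection multiplicity of the curve and the line \<open>l\<close> at \<open>P\<close> is the order of vanishing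
  at \<open>t = 0\<close> of \<open>F (v + t w)\<close>, where \<open>v\<close> spans \<open>P\<close> and \<open>v, w\<close> span \<open>l\<close>. For a form \<open>F\<close> that does not
  vanish identically on \<open>l\<close> it does not depend on \<open>v\<close> and \<open>w\<close>.
\<close>

definition intersection_mult :: "poly3 \<Rightarrow> proj_line \<Rightarrow> proj_point \<Rightarrow> nat" where
  "intersection_mult F l P =
     (if on_line P l
      then THE m. \<forall>v w. v \<in> Rep_proj_point P \<longrightarrow> v \<noteq> 0 \<longrightarrow>
             w \<in> Rep_proj_line l \<longrightarrow> w \<notin> Rep_proj_point P \<longrightarrow>
             Polynomial.order 0 (restrict_line F v w) = m
      else 0)"

definition line_section :: "poly3 \<Rightarrow> proj_line \<Rightarrow> proj_point multiset \<Rightarrow> bool" where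
  \<comment> \<open>\<open>M\<close> consists of all the points of the curve on \<open>l\<close>, counted with multiplicity\<close>
  "line_section F l M \<longleftrightarrow> (\<forall>P. count M P = intersection_mult F l P)"

definition inflection_point :: "poly3 \<Rightarrow> proj_point \<Rightarrow> bool" where
  "inflection_point F P \<longleftrightarrow>
     P \<in> nonsingular_points F \<and> (\<exists>l. intersection_mult F l P \<ge> 3)"


section \<open>The group of a cubic curve\<close>

text \<open>
  For nonsingular \<open>A, B\<close> on an irreducible cubic, \<open>third_point F A B\<close> is the remaining intersection
  of the curve with the line \<open>A B\<close>, or with the tangent at \<open>A\<close> if \<open>A = B\<close>.
\<close>

definition third_point :: "poly3 \<Rightarrow> proj_point \<Rightarrow> proj_point \<Rightarrow> proj_point" where
  "third_point F A B = (THE C. \<exists>l. line_section F l {#A, B, C#})"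

text \<open>
  The chord-tangent group with identity the inflection point \<open>e\<close>. As \<open>e\<close> is its own third point,
  the negative of \<open>A\<close> is \<open>third_point F e A\<close>, and the condition that the three points of a line
  section have sum zero forces \<open>A + B = - third_point F A B\<close>. HOL-Algebra writes the
  operation multiplicatively.
\<close>

definition cubic_group :: "poly3 \<Rightarrow> proj_point \<Rightarrow> proj_point monoid" where
  "cubic_group F e =
     \<lparr>carrier = nonsingular_points F,
      monoid.mult = (\<lambda>A B. third_point F e (third_point F A B)),
      one = e\<rparr>"

end

theory Submission
  imports Defs "HOL-Library.Set_Algebras"
begin

text \<open>
  The group law: in coordinates adapted to the inflection point the cubic is
  \<open>y\<^sup>2 z = x\<^sup>3 + a\<^sub>2 x\<^sup>2 z + a\<^sub>4 x z\<^sup>2 + a\<^sub>6 z\<^sup>3\<close>. Attach to a nonsingular affine point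
  \<open>(x\<^sub>0, y\<^sub>0)\<close> the ideal \<open>(x - x\<^sub>0, y - y\<^sub>0)\<close> of \<open>\<real>[x, y] / (y\<^sup>2 - f)\<close>, and the unit ideal to the
  point at infinity. The product of the ideals of the three points of a line section is
  generated by the equation of the line, and points are determined by the classes of their
  ideals, because a norm \<open>p\<^sup>2 - f q\<^sup>2\<close> never has degree one. This gives associativity.

  The combinatorics: the third point of the line through \<open>b \<in> B\<close> and \<open>g \<in> G\<close> lies in \<open>R\<close>, hence
  \<open>|B + G| \<le> |R| < 3n/2\<close>, which forces \<open>B - B = G - G\<close> to be a subgroup \<open>H\<close> such that \<open>B + G\<close> is
  a coset of \<open>H\<close>.
\<close>

section \<open>Ideals modulo a ring element\<close>

text \<open>Commutativity of the chord-tangent operation is immediate; associativity is the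
  obstacle, since coordinate formulas split into chords, tangents and coincidences. Ideals absorb
  these cases into a few generating identities, and associativity becomes a cancellation. An
  irreducible cubic may be singular, so its coordinate ring need not be integrally closed; it is
  still a domain, and the ideals of nonsingular points are still invertible, which is what
  cancellation uses. The hypotheses place \<open>B\<close> and \<open>G\<close> only on the curve.
  Their points are nonsingular because a line meets the cubic at a singular point with multiplicity
  at least two, which leaves no room for two further points. The factor 3/2 comes from overlaps: two
  translates of an n-element set inside a set of fewer than 3n/2 elements share more than n/2
  elements, and two subsets of an n-element set with more than n/2 elements each must meet.\<close>

interpretation ideal: module "(*) :: 'a::comm_ring_1 \<Rightarrow> 'a \<Rightarrow> 'a"
  by unfold_locales (auto simp: algebra_simps)

declare ideal.scale_scale [simp del] \<comment> \<open>would loop with \<open>mult.assoc\<close>\<close>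

text \<open>Ideals of the quotient by \<open>E\<close> are represented by their preimages:
  \<open>E\<close> is added as a generator and no quotient ring is formed. \<open>ideal.span\<close>
  is the span in the ring as a module over itself, that is, the generated ideal.\<close>

definition ideal_mod :: "'a::comm_ring_1 \<Rightarrow> 'a set \<Rightarrow> 'a set" where
  "ideal_mod E S = ideal.span (insert E S)"

lemma ideal_mod_base: "x \<in> S \<Longrightarrow> x \<in> ideal_mod E S"
  and ideal_mod_modulus: "E \<in> ideal_mod E S"
  and ideal_mod_add: "x \<in> ideal_mod E S \<Longrightarrow> y \<in> ideal_mod E S \<Longrightarrow> x + y \<in> ideal_mod E S"
  and ideal_mod_diff: "x \<in> ideal_mod E S \<Longrightarrow> y \<in> ideal_mod E S \<Longrightarrow> x - y \<in> ideal_mod E S"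
  and ideal_mod_mult: "x \<in> ideal_mod E S \<Longrightarrow> r * x \<in> ideal_mod E S"
  unfolding ideal_mod_def
  by (auto intro: ideal.span_base ideal.span_add ideal.span_diff ideal.span_scale)

lemma ideal_mod_mult_right: "x \<in> ideal_mod E S \<Longrightarrow> x * r \<in> ideal_mod E S"
  using ideal_mod_mult[of x E S r] by (simp add: mult.commute)

lemma ideal_mod_subset_iff: "ideal_mod E S \<subseteq> ideal_mod E T \<longleftrightarrow> S \<subseteq> ideal_mod E T"
proof
  assume "ideal_mod E S \<subseteq> ideal_mod E T"
  then show "S \<subseteq> ideal_mod E T"
    using ideal_mod_base by blast
next
  assume "S \<subseteq> ideal_mod E T"
  then show "ideal_mod E S \<subseteq> ideal_mod E T"
    unfolding ideal_mod_def[of E S]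
    using ideal.span_minimal[of "insert E S" "ideal_mod E T"] ideal.subspace_span[of "insert E T"]
      ideal_mod_modulus[of E T]
    by (simp add: ideal_mod_def)
qed

lemma ideal_mod_singleton_iff: "x \<in> ideal_mod E {g} \<longleftrightarrow> (\<exists>k. E dvd x - k * g)"
proof -
  have "ideal_mod E {g} = ideal.span (insert g {E})"
    by (simp add: ideal_mod_def insert_commute)
  then show ?thesis
    unfolding ideal.span_insert ideal.span_singleton
    by (auto simp: dvd_def mult.commute)
qed

lemma dvd_diff_sym: "(E :: 'a::comm_ring_1) dvd x - y \<Longrightarrow> E dvd y - x"
  by (metis dvd_minus_iff minus_diff_eq)

lemma dvd_diff_trans: "(E :: 'a::comm_ring_1) dvd x - y \<Longrightarrow> E dvd y - z \<Longrightarrow> E dvd x - z"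
  using dvd_add[of E "x - y" "y - z"] by simp

lemma dvd_diff_mult:
  "(E :: 'a::comm_ring_1) dvd x - x' \<Longrightarrow> E dvd y - y' \<Longrightarrow> E dvd x * y - x' * y'"
proof -
  assume "E dvd x - x'" "E dvd y - y'"
  then have "E dvd (x - x') * y + x' * (y - y')" by simp
  then show ?thesis by (simp add: algebra_simps)
qed

text \<open>Makes the elementwise product of generating sets a model of the product of ideals. A
  product with the extra generator \<open>E\<close> need not lie in \<open>S * T\<close> but is a
  multiple of \<open>E\<close>, hence the case splits.\<close>

lemma ideal_mod_times:
  assumes "x \<in> ideal_mod E S" "y \<in> ideal_mod E T"
  shows "x * y \<in> ideal_mod E (S * T)"
proof -
  have *: "s * y \<in> ideal_mod E (S * T)" if "s \<in> S" for s
    using assms(2) unfolding ideal_mod_def[of E T]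
  proof (induction rule: ideal.span_induct_alt)
    case base
    show ?case using ideal_mod_mult[OF ideal_mod_modulus, of 0] by simp
  next
    case (step c x y)
    have "s * x \<in> ideal_mod E (S * T)"
    proof (cases "x = E")
      case True
      then show ?thesis using ideal_mod_mult[OF ideal_mod_modulus] by simp
    next
      case False
      then show ?thesis using step(1) that by (intro ideal_mod_base set_times_intro) auto
    qed
    from ideal_mod_add[OF ideal_mod_mult[OF this, of c] step(2)] show ?case
      by (simp only: distrib_left mult.left_commute)
  qed
  show ?thesis
    using assms(1) unfolding ideal_mod_def[of E S]
  proof (induction rule: ideal.span_induct_alt)
    case base
    show ?case using ideal_mod_mult[OF ideal_mod_modulus, of 0] by simp
  next
    case (step c x x')
    have "x * y \<in> ideal_mod E (S * T)"
    proof (cases "x = E")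
      case True
      then show ?thesis using ideal_mod_mult_right[OF ideal_mod_modulus] by simp
    next
      case False
      then show ?thesis using step(1) * by blast
    qed
    from ideal_mod_add[OF ideal_mod_mult[OF this, of c] step(2)] show ?case
      by (simp only: distrib_right mult.assoc)
  qed
qed

text \<open>Generating sets are compared instead of being replaced by ideals, so that products are
  taken in the commutative monoid of sets and a product over a multiset is available.\<close>

definition ideal_eq :: "'a::comm_ring_1 \<Rightarrow> 'a set \<Rightarrow> 'a set \<Rightarrow> bool" where
  "ideal_eq E S T \<longleftrightarrow> ideal_mod E S = ideal_mod E T"

lemma ideal_eq_iff: "ideal_eq E S T \<longleftrightarrow> S \<subseteq> ideal_mod E T \<and> T \<subseteq> ideal_mod E S"
  unfolding ideal_eq_def by (metis ideal_mod_subset_iff subset_antisym subset_refl)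

lemma ideal_eq_refl: "ideal_eq E S S"
  and ideal_eq_sym: "ideal_eq E S T \<Longrightarrow> ideal_eq E T S"
  and ideal_eq_trans [trans]: "ideal_eq E S T \<Longrightarrow> ideal_eq E T U \<Longrightarrow> ideal_eq E S U"
  by (auto simp: ideal_eq_def)

lemma ideal_eq_times:
  assumes "ideal_eq E S S'" "ideal_eq E T T'"
  shows "ideal_eq E (S * T) (S' * T')"
  using assms unfolding ideal_eq_iff
  by (auto elim!: set_times_elim intro!: ideal_mod_times)

lemma singleton_times_singleton: "{x} * {y} = {x * y :: 'a::times}"
  by (auto simp: set_times_def)

lemma times_singleton_one [simp]: "S * {1} = (S :: 'a::comm_monoid_mult set)"
  by (simp flip: set_one)

text \<open>An elementary operation on generators; it serves to replace \<open>y - y0\<close> by the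
  equation of a line through the point.\<close>

lemma ideal_eq_pair:
  fixes E :: "'a::comm_ring_1"
  assumes "w = v + r * u"
  shows "ideal_eq E {u, w} {u, v}"
proof -
  have "v + r * u \<in> ideal_mod E {u, v}"
    by (intro ideal_mod_add ideal_mod_mult ideal_mod_base) auto
  moreover have "w - r * u \<in> ideal_mod E {u, w}"
    by (intro ideal_mod_diff ideal_mod_mult ideal_mod_base) auto
  ultimately show ?thesis
    using assms by (auto simp: ideal_eq_iff ideal_mod_base)
qed

lemma ideal_eq_singletonI:
  assumes S: "\<And>s. s \<in> S \<Longrightarrow> \<exists>k. E dvd s - k * l"
    and c: "c * l \<in> ideal_mod E S" "c dvd 1"
  shows "ideal_eq E S {l}"
proof -
  obtain d where "1 = c * d" using c(2) by (auto simp: dvd_def)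
  then have "l = (c * d) * l" by simp
  then have "l = d * (c * l)" by (simp only: mult_ac)
  then have "l \<in> ideal_mod E S" using ideal_mod_mult[OF c(1)] by metis
  then show ?thesis
    using S by (auto simp: ideal_eq_iff ideal_mod_singleton_iff)
qed

text \<open>Here \<open>l\<close> is the line, \<open>m\<close> its conjugate, and
  \<open>u1\<close>, \<open>u2\<close>, \<open>u3\<close> cut out the vertical lines through the
  three points. Modulo \<open>E\<close> the product \<open>u1 * u2 * u3\<close> is
  \<open>l * m\<close>, so the product of the ideals is \<open>l\<close> times a second ideal,
  generated by \<open>m\<close>, the products of two of the \<open>u\<close>'s and multiples of
  \<open>l\<close>. The unit \<open>c\<close> certifies that this second ideal is
  everything.\<close>

lemma ideal_eq_line:
  fixes E :: "'a::comm_ring_1"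
  assumes E: "E = l * m - u1 * u2 * u3"
    and c: "c = p * m + q1 * (u2 * u3) + q2 * (u1 * u3) + q3 * (u1 * u2) + r1 * (u1 * l) + r2 * (l * l)"
    and unit: "c dvd 1"
  shows "ideal_eq E ({u1, l} * {u2, l} * {u3, l}) {l}"
proof (rule ideal_eq_singletonI[where c = c])
  let ?S = "{u1, l} * {u2, l} * {u3, l}"
  have 1: "\<exists>k. E dvd u1 * u2 * u3 - k * l"
    by (rule exI[of _ m], rule dvdI[of _ _ "-1"]) (simp add: E mult.commute)
  have 2: "\<exists>k. E dvd x * y * z - k * l" if "x = l \<or> y = l \<or> z = l" for x y z
  proof -
    have "x * y * z = y * z * x" "x * y * z = x * z * y" by (simp_all only: mult_ac)
    then have "\<exists>k. x * y * z = k * l" using that by metis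
    then show ?thesis by (metis diff_self dvd_0_right)
  qed
  show "\<exists>k. E dvd s - k * l" if sS: "s \<in> ?S" for s
  proof -
    obtain t z where t: "s = t * z" "t \<in> {u1, l} * {u2, l}" "z \<in> {u3, l}"
      using sS by (rule set_times_elim)
    obtain x y where "t = x * y" "x \<in> {u1, l}" "y \<in> {u2, l}"
      using t(2) by (rule set_times_elim)
    with t have s: "s = x * y * z" "x \<in> {u1, l}" "y \<in> {u2, l}" "z \<in> {u3, l}" by simp_all
    show ?thesis
    proof (cases "x = l \<or> y = l \<or> z = l")
      case True
      from 2[OF this] show ?thesis unfolding s(1) .
    next
      case False
      then have "s = u1 * u2 * u3" using s by simp
      then show ?thesis using 1 by simp
    qed
  qed
  have I: "r * (x * y * z) \<in> ideal_mod E ?S"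
    if "x \<in> {u1, l}" "y \<in> {u2, l}" "z \<in> {u3, l}" for r x y z
    using that by (intro ideal_mod_mult ideal_mod_base set_times_intro)
  have "c * l = p * E + p * (u1 * u2 * u3) + q1 * (l * u2 * u3) + q2 * (u1 * l * u3)
      + q3 * (u1 * u2 * l) + r1 * (u1 * l * l) + r2 * (l * l * l)"
    unfolding c E by (simp add: algebra_simps)
  also have "\<dots> \<in> ideal_mod E ?S"
    by (rule ideal_mod_add)+
       (rule I ideal_mod_mult[OF ideal_mod_modulus]; simp)+
  finally show "c * l \<in> ideal_mod E ?S" .
  show "c dvd 1" by (rule unit)
qed

lemma ideal_mod_times_singleton:
  assumes "x \<in> ideal_mod E (S * {c :: 'a::comm_ring_1})"
  obtains j where "j \<in> ideal_mod E S" "E dvd x - j * c"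
proof -
  have "\<exists>j\<in>ideal_mod E S. E dvd x - j * c"
    using assms unfolding ideal_mod_def[of E "S * {c}"]
  proof (induction rule: ideal.span_induct_alt)
    case base
    show ?case using ideal_mod_mult[OF ideal_mod_modulus, of 0] by (intro bexI[of _ 0]) auto
  next
    case (step r x y)
    then obtain j where j: "j \<in> ideal_mod E S" "E dvd y - j * c" by blast
    from step(1) have "\<exists>i\<in>ideal_mod E S. E dvd x - i * c"
    proof
      assume "x = E"
      then show ?thesis
        using ideal_mod_mult[OF ideal_mod_modulus, of 0] by (intro bexI[of _ 0]) auto
    next
      assume "x \<in> S * {c}"
      then obtain s where "s \<in> S" "x = s * c" by (auto elim: set_times_elim)
      then show ?thesis using ideal_mod_base[of s S E] by (intro bexI[of _ s]) auto
    qed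
    then obtain i where i: "i \<in> ideal_mod E S" "E dvd x - i * c" by blast
    have "E dvd r * (x - i * c) + (y - j * c)" using i j by simp
    also have "r * (x - i * c) + (y - j * c) = r * x + y - (r * i + j) * c"
      by (simp add: algebra_simps)
    finally show ?case
      using ideal_mod_add[OF ideal_mod_mult[OF i(1)] j(1)] by blast
  qed
  then show ?thesis using that by blast
qed

section \<open>The coordinate ring of a Weierstrass cubic\<close>

text \<open>No condition is put on the discriminant: \<open>f\<close> may have a multiple root, and
  the curve is then singular. Singular points are excluded one by one, through
  \<open>nonsing\<close>.\<close>

locale weierstrass =
  fixes a2 a4 a6 :: real
begin

definition f :: "real poly" where
  "f = [:a6, a4, a2, 1:]"

text \<open>An element of \<open>\<real>[x][y]\<close> with \<open>y\<close> outermost, so that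
  \<open>[:p, q:]\<close> stands for \<open>p + q y\<close>, the normal form modulo this
  polynomial.\<close>

definition curve_eq :: "real poly poly" where
  "curve_eq = [:- f, 0, 1:]"

lemma degree_f: "degree f = 3" and f_nz: "f \<noteq> 0"
  by (auto simp: f_def)

lemma degree_curve_eq: "degree curve_eq = 2"
  by (simp add: curve_eq_def)

lemma curve_eq_reduce: "\<exists>p q. curve_eq dvd g - [:p, q:]"
proof (induction g)
  case 0
  show ?case by (rule exI[of _ 0], rule exI[of _ 0]) simp
next
  case (pCons s g)
  then obtain p q h where h: "g - [:p, q:] = curve_eq * h" by (auto simp: dvd_def)
  then have "g = curve_eq * h + [:p, q:]" by (simp add: algebra_simps)
  then have "pCons s g = [:s:] + [:0, 1:] * (curve_eq * h + [:p, q:])" by simp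
  also have "\<dots> = curve_eq * ([:0, 1:] * h + [:q:]) + [:s + f * q, p:]"
    by (simp add: curve_eq_def algebra_simps)
  finally show ?case by (metis add_diff_cancel_right' dvd_triv_left)
qed

lemma curve_eq_dvd_linear: "curve_eq dvd [:p, q:] \<longleftrightarrow> p = 0 \<and> q = 0"
proof
  assume dvd: "curve_eq dvd [:p, q:]"
  show "p = 0 \<and> q = 0"
  proof (rule ccontr)
    assume "\<not> ?thesis"
    then have "[:p, q:] \<noteq> 0" by auto
    from dvd_imp_degree_le[OF dvd this] show False
      by (simp add: degree_curve_eq split: if_splits)
  qed
qed auto

text \<open>The norm of \<open>p + q y\<close> from the coordinate ring down to
  \<open>\<real>[x]\<close>: its product with the conjugate \<open>p - q y\<close>.\<close>

definition nrm :: "real poly \<Rightarrow> real poly \<Rightarrow> real poly" where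
  "nrm p q = p * p - f * (q * q)"

text \<open>\<open>p * p\<close> has even degree and \<open>f * (q * q)\<close> odd degree, so the
  leading terms cannot cancel.\<close>

lemma degree_nrm: "q \<noteq> 0 \<Longrightarrow> nrm p q \<noteq> 0 \<and> degree (nrm p q) \<ge> 3"
proof -
  assume q: "q \<noteq> 0"
  have dq: "degree (f * (q * q)) = 3 + 2 * degree q"
    using q f_nz by (simp add: degree_mult_eq degree_f)
  have dp: "degree (p * p) = 2 * degree p"
    by (cases "p = 0") (simp_all add: degree_mult_eq)
  have "degree (p * p) \<noteq> degree (f * (q * q))"
    using dp dq by presburger
  then consider "degree (p * p) < degree (f * (q * q))" | "degree (f * (q * q)) < degree (p * p)"
    by linarith
  then have "degree (nrm p q) \<ge> 3"
  proof cases
    case 1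
    then have "degree (nrm p q) = degree (f * (q * q))"
      unfolding nrm_def using degree_add_eq_right[of "p*p" "- (f * (q*q))"] by simp
    then show ?thesis using dq by simp
  next
    case 2
    then have "degree (nrm p q) = degree (p * p)"
      unfolding nrm_def using degree_add_eq_left[of "- (f * (q*q))" "p*p"] by simp
    then show ?thesis using dq 2 by simp
  qed
  then show ?thesis by auto
qed

lemma nrm_eq_0_iff: "nrm p q = 0 \<longleftrightarrow> p = 0 \<and> q = 0"
  using degree_nrm[of q p] by (cases "q = 0") (simp_all add: nrm_def)

lemma linear_mult_cong:
  "curve_eq dvd [:p, q:] * [:r, s:] - [:p * r + f * (q * s), p * s + q * r:]"
  by (rule dvdI[of _ _ "[:q * s:]"]) (simp add: curve_eq_def algebra_simps)

lemma nrm_mult: "nrm (p * r + f * (q * s)) (p * s + q * r) = nrm p q * nrm r s"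
  by (simp add: nrm_def algebra_simps)

lemma curve_eq_mult_reduce:
  assumes "curve_eq dvd g - [:p, q:]" "curve_eq dvd h - [:r, s:]"
  shows "curve_eq dvd g * h - [:p * r + f * (q * s), p * s + q * r:]"
  using dvd_diff_trans[OF dvd_diff_mult[OF assms] linear_mult_cong] .

lemma reduce_unique:
  assumes "curve_eq dvd g - [:p, q:]" "curve_eq dvd g - [:r, s:]"
  shows "p = r" "q = s"
proof -
  have "curve_eq dvd (g - [:r, s:]) - (g - [:p, q:])" using dvd_diff[OF assms(2,1)] .
  moreover have "(g - [:r, s:]) - (g - [:p, q:]) = [:p - r, q - s:]" by simp
  ultimately have "curve_eq dvd [:p - r, q - s:]" by metis
  then show "p = r" "q = s" by (simp_all add: curve_eq_dvd_linear)
qed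

text \<open>The norm is multiplicative and vanishes only at zero, so the coordinate ring is a domain
  even when the curve is singular.\<close>

lemma curve_eq_prime:
  assumes "curve_eq dvd g * h"
  shows "curve_eq dvd g \<or> curve_eq dvd h"
proof -
  obtain p q r s where *: "curve_eq dvd g - [:p, q:]" "curve_eq dvd h - [:r, s:]"
    using curve_eq_reduce by metis
  from curve_eq_mult_reduce[OF this] assms reduce_unique[of "g * h" _ _ 0 0]
  have "p * r + f * (q * s) = 0" "p * s + q * r = 0" by simp_all
  then have "nrm p q * nrm r s = 0"
    by (simp flip: nrm_mult add: nrm_eq_0_iff)
  then show ?thesis using * by (auto simp: nrm_eq_0_iff)
qed

text \<open>The norm \<open>p\<^sup>2 - f q\<^sup>2\<close> never has degree one; this limits the factorizations of a polynomial in
  \<open>x\<close> of small degree.\<close>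

lemma small_degree_factor:
  assumes jk: "curve_eq dvd [:w:] - k * j" and w: "w \<noteq> 0" "degree w \<le> 2"
  shows "(\<exists>r. r \<noteq> 0 \<and> curve_eq dvd k - [:[:r:]:]) \<or>
         (\<exists>p. p \<noteq> 0 \<and> degree p \<le> 1 \<and> curve_eq dvd j - [:p:])"
proof -
  obtain p q r s where *: "curve_eq dvd j - [:p, q:]" "curve_eq dvd k - [:r, s:]"
    using curve_eq_reduce by metis
  have "curve_eq dvd j * k - [:w, 0:]"
    using dvd_diff_sym[OF jk] by (simp add: mult.commute)
  from reduce_unique[OF this curve_eq_mult_reduce[OF *]]
  have eq: "p * r + f * (q * s) = w" "p * s + q * r = 0" by simp_all
  have N: "nrm p q * nrm r s = w * w"
    by (simp flip: nrm_mult add: eq) (simp add: nrm_def)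
  then have "nrm p q \<noteq> 0" "nrm r s \<noteq> 0" using w by auto
  moreover have "degree (w * w) \<le> 4" using w by (simp add: degree_mult_eq)
  ultimately have deg: "degree (nrm p q) + degree (nrm r s) \<le> 4"
    using N by (metis degree_mult_eq)
  show ?thesis
  proof (cases "q = 0")
    case True
    then have "p \<noteq> 0" using \<open>nrm p q \<noteq> 0\<close> by (auto simp: nrm_def)
    then have s: "s = 0" using eq True by simp
    then have w': "w = p * r" using eq by simp
    then have "degree p + degree r \<le> 2" "r \<noteq> 0" using w by (auto simp: degree_mult_eq)
    then consider "degree p \<le> 1" | "degree r = 0" by linarith
    then show ?thesis
    proof cases
      case 1
      then show ?thesis using * True \<open>p \<noteq> 0\<close> by auto
    next
      case 2
      then obtain r0 where "r = [:r0:]" by (metis degree_eq_zeroE)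
      then show ?thesis using * s \<open>r \<noteq> 0\<close> by auto
    qed
  next
    case False
    \<comment> \<open>Of the total degree 4 the norm of \<open>j\<close> takes at least 3, and a
      nonzero norm of degree at most 1 is that of a constant.\<close>
    then have "degree (nrm r s) \<le> 1" using degree_nrm[of q p] deg by linarith
    then have s: "s = 0" using degree_nrm[of s r] by fastforce
    then have "degree (r * r) \<le> 1" "r \<noteq> 0"
      using \<open>degree (nrm r s) \<le> 1\<close> \<open>nrm r s \<noteq> 0\<close> by (auto simp: nrm_def)
    then have "degree r = 0" by (simp add: degree_mult_eq)
    then obtain r0 where "r = [:r0:]" by (metis degree_eq_zeroE)
    then show ?thesis using * s \<open>r \<noteq> 0\<close> by auto
  qed
qed

text \<open>The coordinate ring is free over \<open>\<real>[x]\<close> with basis \<open>1\<close>,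
  \<open>y\<close>, and multiplication by \<open>p\<close> acts on each coordinate.\<close>

lemma linear_in_ideal_poly:
  assumes "[:u, v:] \<in> ideal_mod curve_eq {[:p:]}"
  shows "p dvd u" "p dvd v"
proof -
  obtain k where k: "curve_eq dvd [:u, v:] - k * [:p:]"
    using assms by (auto simp: ideal_mod_singleton_iff)
  obtain r s where rs: "curve_eq dvd k - [:r, s:]" using curve_eq_reduce by metis
  have "curve_eq dvd k * [:p:] - [:r, s:] * [:p:]"
    using dvd_diff_mult[OF rs, of "[:p:]" "[:p:]"] by simp
  from dvd_diff_trans[OF k this] have "curve_eq dvd [:u - p * r, v - p * s:]"
    by (simp add: mult.commute)
  then show "p dvd u" "p dvd v" unfolding curve_eq_dvd_linear by auto
qed

lemma const_dvd_one: "r \<noteq> 0 \<Longrightarrow> [:[:r:]:] dvd (1 :: real poly poly)"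
  by (rule dvdI[of _ _ "[:[:1 / r:]:]"]) (simp add: one_pCons)

text \<open>In the coordinate ring \<open>[:w:] = k * j\<close>. If \<open>k\<close> were constant,
  \<open>w\<close> would generate the ideal and divide the \<open>y\<close>-coefficient of each
  element, which \<open>v\<close> rules out. The degree bound then makes the generator a polynomial
  \<open>p\<close> in \<open>x\<close> alone; it vanishes at the point and divides both coordinates
  of every element in normal form.\<close>

lemma linear_in_principal_ideal:
  assumes S: "ideal_eq curve_eq S {j}" and w: "[:w:] \<in> ideal_mod curve_eq S" "w \<noteq> 0" "degree w \<le> 2"
    and uv: "[:u, v:] \<in> ideal_mod curve_eq S" "\<not> w dvd v"
    and vanish: "\<And>g. g \<in> S \<Longrightarrow> poly (poly g [:y:]) x = 0" and on: "y\<^sup>2 = poly f x"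
  shows "\<exists>p. poly p x = 0 \<and> (\<forall>u v. [:u, v:] \<in> ideal_mod curve_eq S \<longrightarrow> p dvd u \<and> p dvd v)"
proof -
  have eq: "ideal_mod curve_eq S = ideal_mod curve_eq {j}"
    using S by (simp add: ideal_eq_def)
  have cong: "ideal_mod curve_eq {j} \<subseteq> ideal_mod curve_eq {q}" if "curve_eq dvd j - q" for q
    unfolding ideal_mod_subset_iff using that by (auto simp: ideal_mod_singleton_iff intro: exI[of _ 1])
  obtain k where k: "curve_eq dvd [:w:] - k * j"
    using w(1) by (auto simp: eq ideal_mod_singleton_iff)
  have no_const: "\<not> curve_eq dvd k - [:[:r:]:]" if "r \<noteq> 0" for r
  proof
    assume "curve_eq dvd k - [:[:r:]:]"
    then have "curve_eq dvd k * j - [:[:r:]:] * j" by (metis dvd_diff_mult diff_self dvd_0_right)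
    from dvd_diff_sym[OF dvd_diff_trans[OF k this]] have "curve_eq dvd [:[:r:]:] * j - [:w:]" .
    then have "curve_eq dvd [:[:1 / r:]:] * ([:[:r:]:] * j - [:w:])"
      by (rule dvd_mult)
    then have "curve_eq dvd j - [:[:1 / r:]:] * [:w:]"
      using that by (simp add: right_diff_distrib flip: one_pCons)
    then have "j \<in> ideal_mod curve_eq {[:w:]}"
      unfolding ideal_mod_singleton_iff by (rule exI)
    then have "ideal_mod curve_eq {j} \<subseteq> ideal_mod curve_eq {[:w:]}"
      unfolding ideal_mod_subset_iff by simp
    then show False using linear_in_ideal_poly(2)[of u v w] uv eq by auto
  qed
  with small_degree_factor[OF k w(2,3)] obtain p where p: "curve_eq dvd j - [:p:]" by blast
  have "poly (poly g [:y:]) x = 0" if "g \<in> ideal_mod curve_eq S" for g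
    using that unfolding ideal_mod_def
  proof (induction rule: ideal.span_induct_alt)
    case (step c g h)
    have "poly (poly curve_eq [:y:]) x = 0"
      using on by (simp add: curve_eq_def power2_eq_square)
    then show ?case using step vanish by auto
  qed simp
  moreover have "[:p:] \<in> ideal_mod curve_eq S"
    unfolding eq ideal_mod_singleton_iff using dvd_diff_sym[OF p] by (intro exI[of _ 1]) simp
  ultimately have "poly p x = 0" by fastforce
  moreover have "p dvd u \<and> p dvd v" if "[:u, v:] \<in> ideal_mod curve_eq S" for u v
    using linear_in_ideal_poly[of u v p] cong[OF p] that eq by blast
  ultimately show ?thesis by blast
qed

end

section \<open>Points of the curve and the classes of their ideals\<close>

datatype wpoint = Inf | Aff real real

context weierstrass
begin

fun gens :: "wpoint \<Rightarrow> real poly poly set" where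
  "gens Inf = {1}"
| "gens (Aff x y) = {[:[:- x, 1:]:], [:[:- y:], 1:]}"

fun opp :: "wpoint \<Rightarrow> wpoint" where
  "opp Inf = Inf"
| "opp (Aff x y) = Aff x (- y)"

fun nonsing :: "wpoint \<Rightarrow> bool" where
  "nonsing Inf \<longleftrightarrow> True"
| "nonsing (Aff x y) \<longleftrightarrow> y\<^sup>2 = poly f x \<and> (y \<noteq> 0 \<or> poly (pderiv f) x \<noteq> 0)"

text \<open>\<open>M\<close> plays the role of an effective divisor, with \<open>Inf\<close>
  contributing the unit ideal, and the predicate says that its class is trivial. The generator must
  be nonzero in the coordinate ring, since cancellation divides by it.\<close>

definition principal :: "wpoint multiset \<Rightarrow> bool" where
  "principal M \<longleftrightarrow>
     (\<exists>l. \<not> curve_eq dvd l \<and> ideal_eq curve_eq (\<Prod>P\<in>#M. gens P) {l})"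

lemma principal_add:
  assumes "principal M" "principal N"
  shows "principal (M + N)"
proof -
  obtain l m where "\<not> curve_eq dvd l" "ideal_eq curve_eq (\<Prod>P\<in>#M. gens P) {l}"
    "\<not> curve_eq dvd m" "ideal_eq curve_eq (\<Prod>P\<in>#N. gens P) {m}"
    using assms by (auto simp: principal_def)
  then show ?thesis
    unfolding principal_def using curve_eq_prime[of l m] ideal_eq_times[of curve_eq _ "{l}" _ "{m}"]
    by (intro exI[of _ "l * m"]) (auto simp: singleton_times_singleton)
qed

text \<open>If \<open>c\<close> generates the ideal of \<open>N\<close> and \<open>d\<close> that of
  \<open>M + N\<close>, then \<open>d = j * c\<close> with \<open>j\<close> in the ideal of
  \<open>M\<close>. For each generator \<open>s\<close> of that ideal, \<open>s * c\<close> is a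
  multiple of \<open>d = j * c\<close>, and cancelling \<open>c\<close> in the domain shows that
  \<open>s\<close> is a multiple of \<open>j\<close>.\<close>

lemma principal_cancel:
  assumes "principal (M + N)" "principal N"
  shows "principal M"
proof -
  define S where "S = (\<Prod>P\<in>#M. gens P)"
  obtain d where d: "\<not> curve_eq dvd d" "ideal_eq curve_eq (S * (\<Prod>P\<in>#N. gens P)) {d}"
    using assms by (auto simp: principal_def S_def)
  obtain c where c: "\<not> curve_eq dvd c" "ideal_eq curve_eq (\<Prod>P\<in>#N. gens P) {c}"
    using assms by (auto simp: principal_def)
  have Sd: "ideal_eq curve_eq (S * {c}) {d}"
    using ideal_eq_times[OF ideal_eq_refl c(2), of S] d(2) by (metis ideal_eq_sym ideal_eq_trans)
  then obtain j where j: "j \<in> ideal_mod curve_eq S" "curve_eq dvd d - j * c"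
    by (auto simp: ideal_eq_iff elim: ideal_mod_times_singleton)
  have "\<exists>k. curve_eq dvd s - k * j" if "s \<in> S" for s
  proof -
    have "s * c \<in> ideal_mod curve_eq {d}" using Sd that by (auto simp: ideal_eq_iff)
    then obtain k where k: "curve_eq dvd s * c - k * d" by (auto simp: ideal_mod_singleton_iff)
    have "curve_eq dvd k * d - k * (j * c)" using j(2) by (simp flip: right_diff_distrib)
    from dvd_diff_trans[OF k this] have "curve_eq dvd (s - k * j) * c" by (simp add: algebra_simps)
    then show ?thesis using curve_eq_prime c(1) by blast
  qed
  then have "ideal_eq curve_eq S {j}"
    using j(1) by (auto simp: ideal_eq_iff ideal_mod_singleton_iff)
  moreover have "\<not> curve_eq dvd j"
    using j(2) d(1) by (metis diff_add_cancel dvd_add dvd_mult2)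
  ultimately show ?thesis unfolding principal_def S_def by blast
qed

text \<open>With \<open>w\<close> the linear polynomial of the abscissa, the ideal would be
  generated by a polynomial in \<open>x\<close> that has a root and yet divides the coefficient
  \<open>1\<close> of \<open>y\<close>.\<close>

lemma not_principal_Aff:
  assumes "y\<^sup>2 = poly f x"
  shows "\<not> principal {#Aff x y#}"
proof
  assume "principal {#Aff x y#}"
  then obtain l where l: "ideal_eq curve_eq (gens (Aff x y)) {l}"
    by (auto simp: principal_def)
  have y: "[:[:- y:], 1:] \<in> ideal_mod curve_eq (gens (Aff x y))"
    by (rule ideal_mod_base) simp
  have nd: "\<not> [:- x, 1:] dvd (1 :: real poly)"
    by (simp add: poly_eq_0_iff_dvd[symmetric])
  have u: "[:[:- x, 1:]:] \<in> ideal_mod curve_eq (gens (Aff x y))"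
    by (rule ideal_mod_base) simp
  have vanish: "poly (poly g [:y:]) x = 0" if "g \<in> gens (Aff x y)" for g
    using that by auto
  obtain p where p: "poly p x = 0"
      "\<And>u v. [:u, v:] \<in> ideal_mod curve_eq (gens (Aff x y)) \<Longrightarrow> p dvd u \<and> p dvd v"
    using linear_in_principal_ideal[OF l u _ _ y nd vanish assms] by auto
  from p(2)[OF y] have "p dvd 1" by simp
  with p(1) show False by (auto elim!: dvdE dest!: arg_cong[of _ _ "\<lambda>q. poly q x"])
qed

text \<open>Points are separated by their classes. Here \<open>w\<close> is a product of two linear
  polynomials, which is why the degree bound admits two. The resulting \<open>p\<close> vanishes at
  \<open>x\<close> and divides two \<open>y\<close>-coefficients occurring in the ideal, the linear
  polynomial with root \<open>x'\<close> and the constant \<open>y' - y\<close>, so both vanish at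
  \<open>x\<close>.\<close>

lemma principal_opp_imp_eq:
  assumes "principal {#P, opp Q#}" "nonsing P" "nonsing Q"
  shows "P = Q"
proof (cases P)
  case Inf
  then have "principal {#opp Q#}" using assms by (simp add: principal_def flip: set_one)
  then show ?thesis using Inf not_principal_Aff assms(3) by (cases Q) auto
next
  case P: (Aff x y)
  show ?thesis
  proof (cases Q)
    case Inf
    then have "principal {#P#}" using assms by (simp add: principal_def flip: set_one)
    then show ?thesis using not_principal_Aff assms P by auto
  next
    case Q: (Aff x' y')
    let ?S = "gens (Aff x y) * gens (Aff x' (- y'))"
    obtain l where l: "ideal_eq curve_eq ?S {l}"
      using assms(1) P Q by (auto simp: principal_def)
    have mem: "g * h \<in> ideal_mod curve_eq ?S"
      if "g \<in> gens (Aff x y)" "h \<in> gens (Aff x' (- y'))" for g h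
      using that by (intro ideal_mod_base set_times_intro)
    have 1: "[:[:- x, 1:] * [:- x', 1:]:] \<in> ideal_mod curve_eq ?S"
      using mem[of "[:[:- x, 1:]:]" "[:[:- x', 1:]:]"] by (simp add: algebra_simps)
    have 2: "[:- smult y [:- x', 1:], [:- x', 1:]:] \<in> ideal_mod curve_eq ?S"
      using mem[of "[:[:- y:], 1:]" "[:[:- x', 1:]:]"] by (simp add: one_pCons)
    \<comment> \<open>Subtracting the modulus replaces the square of the variable \<open>y\<close>
      by \<open>f\<close> and gives the normal form.\<close>
    have "[:[:- y:], 1:] * [:[:y':], 1:] - curve_eq \<in> ideal_mod curve_eq ?S"
      by (intro ideal_mod_diff mem ideal_mod_modulus) simp_all
    also have "[:[:- y:], 1:] * [:[:y':], 1:] - curve_eq = [:f - [:y * y':], [:y' - y:]:]"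
      by (simp add: curve_eq_def one_pCons)
    finally have 3: "[:f - [:y * y':], [:y' - y:]:] \<in> ideal_mod curve_eq ?S" .
    have deg: "degree ([:- x, 1:] * [:- x', 1:]) = 2" by (simp add: degree_mult_eq)
    have nd: "\<not> [:- x, 1:] * [:- x', 1:] dvd [:- x', 1:]"
    proof
      assume "[:- x, 1:] * [:- x', 1:] dvd [:- x', 1:]"
      from dvd_imp_degree_le[OF this] show False by (simp add: degree_mult_eq)
    qed
    have vanish: "poly (poly g [:y:]) x = 0" if "g \<in> ?S" for g
      using that by (auto elim!: set_times_elim simp: algebra_simps)
    have on: "y\<^sup>2 = poly f x" using assms(2) P by simp
    have nz: "[:- x, 1:] * [:- x', 1:] \<noteq> 0" using deg by fastforce
    obtain p where p: "poly p x = 0"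
      "\<And>u v. [:u, v:] \<in> ideal_mod curve_eq ?S \<Longrightarrow> p dvd u \<and> p dvd v"
      using linear_in_principal_ideal[OF l 1 nz _ 2 nd vanish on] deg by auto
    have "poly [:- x', 1:] x = 0" "poly [:y' - y:] x = 0"
      using p(1) p(2)[OF 2] p(2)[OF 3] by (auto elim!: dvdE simp del: poly_pCons)
    then show ?thesis using P Q by simp
  qed
qed

text \<open>The vertical line through an affine \<open>P\<close> cuts out \<open>P\<close> and its
  opposite, and its equation generates the product. Nonsingularity enters here: one of the partial
  derivatives, \<open>2 * y\<close> or the value of \<open>pderiv f\<close>, supplies the
  unit.\<close>

lemma principal_opp:
  assumes "nonsing P"
  shows "principal {#P, opp P#}"
proof (cases P)
  case Inf
  have "\<not> curve_eq dvd [:1, 0:]" unfolding curve_eq_dvd_linear by simp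
  then show ?thesis
    using Inf by (auto simp: principal_def singleton_times_singleton intro: ideal_eq_refl exI[of _ 1])
next
  case P: (Aff x y)
  let ?S = "gens (Aff x y) * gens (Aff x (- y))" and ?u = "[:[:- x, 1:]:] :: real poly poly"
  have on: "y\<^sup>2 = poly f x" using assms P by simp
  then have "poly (f - [:y * y:]) x = 0" by (simp add: power2_eq_square)
  then obtain h where h: "f - [:y * y:] = [:- x, 1:] * h" unfolding poly_eq_0_iff_dvd by (auto elim: dvdE simp del: mult_pCons_left)
  then have f: "f = [:- x, 1:] * h + [:y * y:]" by (simp add: algebra_simps)
  have yy: "[:[:- y:], 1:] * [:[:y:], 1:] = curve_eq + [:h:] * ?u"
    by (simp add: curve_eq_def f one_pCons)
  have mem: "g * h \<in> ideal_mod curve_eq ?S"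
    if "g \<in> gens (Aff x y)" "h \<in> gens (Aff x (- y))" for g h
    using that by (intro ideal_mod_base set_times_intro)
  have "\<exists>c. c * ?u \<in> ideal_mod curve_eq ?S \<and> c dvd 1"
  proof (cases "y = 0")
    case False
    have "?u * [:[:y:], 1:] - [:[:- y:], 1:] * ?u \<in> ideal_mod curve_eq ?S"
      by (intro ideal_mod_diff mem) auto
    also have "?u * [:[:y:], 1:] - [:[:- y:], 1:] * ?u = [:[:2 * y:]:] * ?u"
      by simp
    finally show ?thesis using False const_dvd_one[of "2 * y"] by (intro exI conjI) simp_all
  next
    case True
    have "pderiv f = h + [:- x, 1:] * pderiv h"
      unfolding f pderiv_add pderiv_mult by (simp add: pderiv_pCons)
    then have hx: "poly h x \<noteq> 0" using assms P True by simp
    have "[:- x, 1:] dvd h - [:poly h x:]" by (simp flip: poly_eq_0_iff_dvd)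
    then obtain h' where h': "h - [:poly h x:] = [:- x, 1:] * h'" by (auto elim: dvdE)
    then have "h = [:poly h x:] + [:- x, 1:] * h'" by (simp add: algebra_simps)
    then have hu: "[:h:] = [:[:poly h x:]:] + [:h':] * ?u" by (simp add: mult.commute)
    \<comment> \<open>At ordinate zero the product of the two second generators is
      \<open>[:h:] * ?u\<close> modulo the curve. Splitting \<open>h\<close> into its value at
      \<open>x\<close> and a multiple of the linear polynomial leaves a nonzero constant times
      \<open>?u\<close>.\<close>
    have "[:[:- y:], 1:] * [:[:y:], 1:] - curve_eq - [:h':] * (?u * ?u) \<in> ideal_mod curve_eq ?S"
      by (intro ideal_mod_diff ideal_mod_mult[of "?u * ?u"] mem ideal_mod_modulus; simp)
    also have "[:[:- y:], 1:] * [:[:y:], 1:] - curve_eq - [:h':] * (?u * ?u) = [:[:poly h x:]:] * ?u"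
      unfolding yy hu by (simp only: algebra_simps)
    finally show ?thesis using const_dvd_one[OF hx] by blast
  qed
  then obtain c where c: "c * ?u \<in> ideal_mod curve_eq ?S" "c dvd 1" by blast
  have "ideal_eq curve_eq ?S {?u}"
  proof (rule ideal_eq_singletonI[OF _ c])
    fix s assume "s \<in> ?S"
    then obtain g h' where gh: "s = g * h'" "g \<in> gens (Aff x y)" "h' \<in> gens (Aff x (- y))"
      by (rule set_times_elim)
    consider "h' = ?u" | "g = ?u" | "g = [:[:- y:], 1:]" "h' = [:[:y:], 1:]"
      using gh by fastforce
    then consider t where "s = t * ?u" | "s = [:[:- y:], 1:] * [:[:y:], 1:]"
      using gh(1) by cases (metis mult.commute)+
    then show "\<exists>k. curve_eq dvd s - k * ?u"
    proof cases
      case 1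
      then show ?thesis by (intro exI[of _ t]) simp
    next
      case 2
      then show ?thesis by (intro exI[of _ "[:h:]"]) (simp only: yy, simp)
    qed
  qed
  moreover have "\<not> curve_eq dvd [:[:- x, 1:], 0:]" unfolding curve_eq_dvd_linear by simp
  ultimately show ?thesis unfolding principal_def using P by (intro exI[of _ ?u]) simp
qed

text \<open>Opposite points supply inverse classes, so the common part \<open>M\<close> can be
  completed to a principal \<open>M + N\<close> and cancelled; what remains is \<open>P\<close>
  together with the opposite of \<open>Q\<close>.\<close>

lemma principal_unique:
  assumes "principal (add_mset P M)" "principal (add_mset Q M)"
    and "\<And>R. R \<in># M \<Longrightarrow> nonsing R" "nonsing P" "nonsing Q"
  shows "P = Q"
proof -
  have "\<exists>N. principal (M + N)" using assms(3)
  proof (induction M)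
    case empty
    show ?case
      using principal_opp[of Inf] by (intro exI[of _ "{#Inf, Inf#}"]) simp
  next
    case (add R M)
    then obtain N where "principal (M + N)" by auto
    from principal_add[OF this principal_opp[of R]] add(2) show ?case
      by (intro exI[of _ "add_mset (opp R) N"]) (simp add: add_mset_commute)
  qed
  then obtain N where N: "principal (M + N)" by blast
  have "principal ({#P, opp Q#} + (add_mset Q M + (M + N)))"
    using principal_add[OF assms(1) principal_add[OF principal_opp[OF assms(5)] N]]
    by (simp add: add_mset_commute)
  from principal_cancel[OF this principal_add[OF assms(2) N]] show ?thesis
    using principal_opp_imp_eq assms(4,5) by blast
qed

section \<open>Line sections in Weierstrass coordinates\<close>

definition line_triple :: "real \<Rightarrow> real \<Rightarrow> real \<Rightarrow> real \<Rightarrow> real \<Rightarrow> wpoint multiset \<Rightarrow> bool" where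
  "line_triple l m x1 x2 x3 M \<longleftrightarrow>
     f - [:m, l:]\<^sup>2 = [:- x1, 1:] * [:- x2, 1:] * [:- x3, 1:] \<and>
     M = {#Aff x1 (l * x1 + m), Aff x2 (l * x2 + m), Aff x3 (l * x3 + m)#}"

text \<open>The cases are the line at infinity, the vertical lines and the lines
  \<open>y = l x + m\<close>, as far as all three intersections are real. The line at infinity is
  the inflectional tangent, hence the triple \<open>Inf\<close>.\<close>

definition wsection :: "wpoint multiset \<Rightarrow> bool" where
  "wsection M \<longleftrightarrow> M = {#Inf, Inf, Inf#} \<or>
     (\<exists>x y. y\<^sup>2 = poly f x \<and> M = {#Inf, Aff x y, Aff x (- y)#}) \<or>
     (\<exists>l m x1 x2 x3. line_triple l m x1 x2 x3 M)"

text \<open>The certificate for \<open>ideal_eq_line\<close> is found in two cases: three distinct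
  abscissas, or a tangent at the first point. Other coincidences reduce to these by
  permutation.\<close>

lemma principal_line:
  assumes fact: "f - [:m, l:]\<^sup>2 = [:- x1, 1:] * [:- x2, 1:] * [:- x3, 1:]"
    and x: "x1 \<noteq> x2 \<and> x1 \<noteq> x3 \<and> x2 \<noteq> x3 \<or> x1 = x2"
    and ns: "nonsing (Aff x1 (l * x1 + m))"
  shows "principal {#Aff x1 (l * x1 + m), Aff x2 (l * x2 + m), Aff x3 (l * x3 + m)#}"
proof -
  let ?L = "[:- [:m, l:], 1:] :: real poly poly" and ?M = "[:[:m, l:], 1:] :: real poly poly"
  let ?u = "\<lambda>x. [:[:- x, 1:]:] :: real poly poly"
  have g: "ideal_eq curve_eq (gens (Aff x (l * x + m))) {?u x, ?L}" for x
    by (simp only: gens.simps, rule ideal_eq_pair[where r = "[:[:l:]:]"]) (simp add: one_pCons)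
  have "ideal_eq curve_eq (\<Prod>P\<in>#{#Aff x1 (l * x1 + m), Aff x2 (l * x2 + m), Aff x3 (l * x3 + m)#}. gens P)
      ({?u x1, ?L} * {?u x2, ?L} * {?u x3, ?L})"
    using ideal_eq_times[OF ideal_eq_times[OF g[of x1] g[of x2]] g[of x3]]
    by (simp add: mult.assoc del: gens.simps)
  also have "ideal_eq curve_eq \<dots> {?L}"
  proof -
    have E: "curve_eq = ?L * ?M - ?u x1 * ?u x2 * ?u x3"
    proof -
      have "f = [:m, l:] * [:m, l:] + [:- x1, 1:] * [:- x2, 1:] * [:- x3, 1:]"
        using fact by (simp only: power2_eq_square diff_eq_eq add.commute)
      then show ?thesis by (simp add: curve_eq_def one_pCons)
    qed
    show ?thesis
    proof (cases "x1 = x2")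
      case False
      \<comment> \<open>Lagrange interpolation of the constant \<open>1\<close> at the three
        abscissas, with denominators cleared; hence the Vandermonde product.\<close>
      define c where "c = [:[:(x1 - x2) * (x2 - x3) * (x1 - x3):]:]"
      have "c = 0 * ?M + [:[:x2 - x3:]:] * (?u x2 * ?u x3) + [:[:x3 - x1:]:] * (?u x1 * ?u x3)
        + [:[:x1 - x2:]:] * (?u x1 * ?u x2) + 0 * (?u x1 * ?L) + 0 * (?L * ?L)"
        by (simp add: c_def algebra_simps)
      moreover have "c dvd 1" unfolding c_def using False x by (intro const_dvd_one) auto
      ultimately show ?thesis by (rule ideal_eq_line[OF E])
    next
      case True
      define y where "y = l * x1 + m"
      \<comment> \<open>With a double root at \<open>x1\<close> the derivative of \<open>f\<close>
        there is \<open>2 * l * y\<close>, so \<open>y = 0\<close> would make the point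
        singular.\<close>
      have "y \<noteq> 0"
      proof
        assume "y = 0"
        have "f = [:m, l:]\<^sup>2 + [:- x1, 1:] * [:- x1, 1:] * [:- x3, 1:]"
          using fact True by (simp only: diff_eq_eq add.commute)
        then have "poly (pderiv f) x1 = 2 * l * y"
          by (simp add: y_def pderiv_add pderiv_mult pderiv_pCons power2_eq_square algebra_simps)
        then show False using ns \<open>y = 0\<close> unfolding y_def by simp
      qed
      \<comment> \<open>Since \<open>?M\<close> equals \<open>2 y + (?L + 2 l u)\<close> with
        \<open>u = ?u x1\<close>, the difference of squares
        \<open>(2 y)\<^sup>2 - (?L + 2 l u)\<^sup>2\<close> is a multiple of \<open>?M\<close>;
        expanding the second square gives terms allowed in the certificate, because
        \<open>x2 = x1\<close>.\<close>
      define c where "c = [:[:4 * y * y:]:]"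
      have "c = ([:[:2 * y:]:] - ?L - [:[:2 * l:]:] * ?u x1) * ?M + 0 * (?u x2 * ?u x3)
        + 0 * (?u x1 * ?u x3) + [:[:4 * l * l:]:] * (?u x1 * ?u x2)
        + [:[:4 * l:]:] * (?u x1 * ?L) + 1 * (?L * ?L)"
        by (simp add: c_def True y_def one_pCons algebra_simps)
      moreover have "c dvd 1" unfolding c_def using \<open>y \<noteq> 0\<close> by (intro const_dvd_one) auto
      ultimately show ?thesis by (rule ideal_eq_line[OF E])
    qed
  qed
  finally show ?thesis
    unfolding principal_def using curve_eq_dvd_linear[of "- [:m, l:]" 1] by (intro exI[of _ ?L]) simp
qed

lemma principal_wsection:
  assumes M: "wsection M" and ns: "\<And>P. P \<in># M \<Longrightarrow> nonsing P"
  shows "principal M"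
proof -
  have Inf: "principal {#Inf#}"
    using principal_opp[of Inf] by (simp add: principal_def singleton_times_singleton)
  consider "M = {#Inf, Inf, Inf#}" | x y where "M = {#Inf, Aff x y, Aff x (- y)#}"
    | l m x1 x2 x3 where "line_triple l m x1 x2 x3 M"
    using M unfolding wsection_def by blast
  then show ?thesis
  proof cases
    case 1
    then show ?thesis using principal_add[OF Inf principal_add[OF Inf Inf]] by simp
  next
    case 2
    then show ?thesis using principal_add[OF Inf principal_opp[of "Aff x y"]] ns[of "Aff x y"]
      by (simp add: add_mset_commute)
  next
    case 3
    then have fact: "f - [:m, l:]\<^sup>2 = [:- x1, 1:] * [:- x2, 1:] * [:- x3, 1:]"
      and eq: "M = {#Aff x1 (l * x1 + m), Aff x2 (l * x2 + m), Aff x3 (l * x3 + m)#}"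
      by (auto simp: line_triple_def)
    have ns': "nonsing (Aff x1 (l * x1 + m))" "nonsing (Aff x2 (l * x2 + m))"
      using ns[of "Aff x1 (l * x1 + m)"] ns[of "Aff x2 (l * x2 + m)"] unfolding eq
      by (simp_all del: nonsing.simps)
    consider "x1 \<noteq> x2 \<and> x1 \<noteq> x3 \<and> x2 \<noteq> x3 \<or> x1 = x2" | "x1 = x3" | "x2 = x3" by blast
    then show ?thesis
    proof cases
      case 1
      then show ?thesis using principal_line[OF fact 1 ns'(1)] eq by simp
    next
      case 2
      have "f - [:m, l:]\<^sup>2 = [:- x1, 1:] * [:- x3, 1:] * [:- x2, 1:]"
        using fact by (simp only: mult_ac)
      from principal_line[OF this _ ns'(1)] show ?thesis using eq 2 by (simp add: add_mset_commute)
    next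
      case 3
      have "f - [:m, l:]\<^sup>2 = [:- x2, 1:] * [:- x3, 1:] * [:- x1, 1:]"
        using fact by (simp only: mult_ac)
      from principal_line[OF this _ ns'(2)] show ?thesis using eq 3 by (simp add: add_mset_commute)
    qed
  qed
qed

text \<open>Two real roots, counted with multiplicity, leave a monic linear factor, so the third
  root is real as well.\<close>

lemma monic_cubic_factor:
  assumes D: "degree (D :: real poly) = 3" "lead_coeff D = 1" "D = [:- x1, 1:] * q" "poly q x2 = 0"
  obtains x3 where "D = [:- x1, 1:] * [:- x2, 1:] * [:- x3, 1:]"
proof -
  obtain r where r: "q = [:- x2, 1:] * r" using D(4) by (auto simp only: poly_eq_0_iff_dvd dvd_def)
  have D': "D = [:- x1, 1:] * ([:- x2, 1:] * r)" using D(3) r by simp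
  have "r \<noteq> 0" using D' D(1) by auto
  then have "degree D = degree r + 2"
    unfolding D' by (simp add: degree_mult_eq del: mult_pCons_left)
  then have "degree r = 1" using D(1) by simp
  moreover have "lead_coeff r = 1" using D(2) unfolding D' lead_coeff_mult by simp
  ultimately have "r = [:- (- coeff r 0), 1:]"
    by (intro poly_eqI) (auto simp: coeff_pCons coeff_eq_0 split: nat.split)
  then show ?thesis using that D' by (metis mult.assoc)
qed

lemma monic_line_diff: "degree (f - [:m, l:]\<^sup>2) = 3" "lead_coeff (f - [:m, l:]\<^sup>2) = 1"
proof -
  have *: "f - [:m, l:]\<^sup>2 = [:a6 - m * m, a4 - 2 * m * l, a2 - l * l, 1:]"
    by (simp add: f_def power2_eq_square)
  show "degree (f - [:m, l:]\<^sup>2) = 3" "lead_coeff (f - [:m, l:]\<^sup>2) = 1"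
    unfolding * by simp_all
qed

text \<open>At a root \<open>x3\<close> other than \<open>x1\<close> and \<open>x2\<close>, the
  derivative of \<open>f\<close> is \<open>2 * l\<close> times the ordinate plus the nonzero number
  \<open>(x3 - x1) * (x3 - x2)\<close>, so it cannot vanish together with the ordinate: a singular
  point would be a multiple root.\<close>

lemma nonsing_third:
  assumes fact: "f - [:m, l:]\<^sup>2 = [:- x1, 1:] * [:- x2, 1:] * [:- x3, 1:]"
    and "x3 = x1 \<Longrightarrow> nonsing (Aff x1 (l * x1 + m))" "x3 = x2 \<Longrightarrow> nonsing (Aff x2 (l * x2 + m))"
  shows "nonsing (Aff x3 (l * x3 + m))"
proof (cases "x3 = x1 \<or> x3 = x2")
  case True
  then show ?thesis using assms by auto
next
  case False
  have f: "f = [:m, l:] * [:m, l:] + [:- x1, 1:] * [:- x2, 1:] * [:- x3, 1:]"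
    using fact by (simp only: power2_eq_square diff_eq_eq add.commute)
  have "poly f x3 = (l * x3 + m)\<^sup>2"
    unfolding f by (simp add: power2_eq_square algebra_simps)
  moreover have "poly (pderiv f) x3 = 2 * l * (l * x3 + m) + (x3 - x1) * (x3 - x2)"
    unfolding f pderiv_add pderiv_mult by (simp add: pderiv_pCons algebra_simps)
  ultimately show ?thesis using False by auto
qed

lemma wsection_third_exists:
  assumes P: "nonsing P" and Q: "nonsing Q"
  shows "\<exists>R. nonsing R \<and> wsection {#P, Q, R#}"
proof (cases "P = Inf \<or> Q = Inf")
  case True
  have T: "wsection {#Inf, T, opp T#}" "nonsing (opp T)" if "nonsing T" for T
    using that by (cases T; auto simp: wsection_def)+
  show ?thesis
  proof (cases "P = Inf")
    case True
    then show ?thesis using T Q by blast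
  next
    case False
    then have "Q = Inf" using True by simp
    then show ?thesis using T P by (metis add_mset_commute)
  qed
next
  case False
  then obtain x1 y1 x2 y2 where eq: "P = Aff x1 y1" "Q = Aff x2 y2"
    by (metis wpoint.exhaust)
  have on: "y1\<^sup>2 = poly f x1" "y2\<^sup>2 = poly f x2" using P Q eq by auto
  show ?thesis
  proof (cases "x1 = x2 \<and> y2 = - y1")
    case True
    then show ?thesis using on eq
      by (intro exI[of _ Inf]) (auto simp: wsection_def add_mset_commute)
  next
    case ne: False
    \<comment> \<open>Chord or tangent. In either case the cofactor \<open>q\<close> vanishes at
      \<open>x2\<close>; for equal points this is because the tangent slope makes \<open>x1\<close>
      a double root.\<close>
    obtain l m q where lm: "y1 = l * x1 + m" "y2 = l * x2 + m"
      and q: "f - [:m, l:]\<^sup>2 = [:- x1, 1:] * q" "poly q x2 = 0"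
    proof (cases "x1 = x2")
      case True
      then have "y2\<^sup>2 = y1\<^sup>2" using on by simp
      then have y: "y2 = y1" "y1 \<noteq> 0" using ne True by (auto simp: power2_eq_iff)
      define l m where "l = poly (pderiv f) x1 / (2 * y1)" and "m = y1 - l * x1"
      have "poly (f - [:m, l:]\<^sup>2) x1 = 0" using on by (simp add: m_def)
      then obtain q where q: "f - [:m, l:]\<^sup>2 = [:- x1, 1:] * q"
        by (auto simp only: poly_eq_0_iff_dvd dvd_def)
      have "poly (pderiv (f - [:m, l:]\<^sup>2)) x1 = poly (pderiv f) x1 - 2 * l * y1"
        unfolding power2_eq_square pderiv_diff pderiv_mult
        by (simp add: m_def pderiv_pCons algebra_simps)
      also have "\<dots> = 0" using y by (simp add: l_def)
      finally have "poly q x1 = 0" unfolding q pderiv_mult by (simp add: pderiv_pCons)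
      then show ?thesis using that[of l m q] q y True by (simp add: m_def)
    next
      case False
      define l m where "l = (y1 - y2) / (x1 - x2)" and "m = y1 - l * x1"
      have "l * (x1 - x2) = y1 - y2" using False by (simp add: l_def)
      then have lm: "y1 = l * x1 + m" "y2 = l * x2 + m" by (simp_all add: m_def algebra_simps)
      have "poly (f - [:m, l:]\<^sup>2) x1 = 0" using on by (simp add: m_def)
      then obtain q where q: "f - [:m, l:]\<^sup>2 = [:- x1, 1:] * q"
        by (auto simp only: poly_eq_0_iff_dvd dvd_def)
      have "poly (f - [:m, l:]\<^sup>2) x2 = 0" using on lm by (simp add: algebra_simps)
      then have "poly q x2 = 0" unfolding q using False by simp
      then show ?thesis using that[of l m q] q lm by simp
    qed
    obtain x3 where fact: "f - [:m, l:]\<^sup>2 = [:- x1, 1:] * [:- x2, 1:] * [:- x3, 1:]"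
      using monic_cubic_factor[OF monic_line_diff q] by blast
    have "nonsing (Aff x3 (l * x3 + m))"
      by (rule nonsing_third[OF fact]) (use P Q eq lm in simp_all)
    moreover have "wsection {#P, Q, Aff x3 (l * x3 + m)#}"
      unfolding wsection_def line_triple_def using fact eq lm by blast
    ultimately show ?thesis by blast
  qed
qed

section \<open>Collinear points of the curve\<close>

fun on_wline :: "real \<Rightarrow> real \<Rightarrow> real \<Rightarrow> wpoint \<Rightarrow> bool" where
  "on_wline u v w Inf \<longleftrightarrow> v = 0"
| "on_wline u v w (Aff x y) \<longleftrightarrow> u * x + v * y + w = 0"

fun on_wcurve :: "wpoint \<Rightarrow> bool" where
  "on_wcurve Inf \<longleftrightarrow> True"
| "on_wcurve (Aff x y) \<longleftrightarrow> y\<^sup>2 = poly f x"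

text \<open>\<open>Inf\<close> is \<open>(0 : 1 : 0)\<close>, so \<open>v = 0\<close> and the line
  is vertical. Two distinct affine points on it have opposite ordinates, which are therefore nonzero
  and make both points nonsingular.\<close>

lemma collinear_Inf:
  assumes "u \<noteq> 0 \<or> v \<noteq> 0 \<or> w \<noteq> 0" "P \<noteq> Inf" "Q \<noteq> Inf" "P \<noteq> Q"
    "on_wline u v w Inf" "on_wline u v w P" "on_wline u v w Q" "on_wcurve P" "on_wcurve Q"
  shows "nonsing P \<and> nonsing Q \<and> wsection {#Inf, P, Q#}"
proof -
  obtain x y x' y' where eq: "P = Aff x y" "Q = Aff x' y'" using assms by (metis wpoint.exhaust)
  have *: "v = 0" "u * x + w = 0" "u * x' + w = 0" using assms eq by auto
  then have "u \<noteq> 0" using assms(1) by (cases "u = 0") auto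
  moreover have "u * x' = u * x" using *(2,3) by linarith
  ultimately have "x' = x" by simp
  moreover have "y\<^sup>2 = y'\<^sup>2" using assms eq calculation by simp
  ultimately have "y' = - y" "y \<noteq> 0" using assms eq by (auto simp: power2_eq_iff)
  then show ?thesis using assms eq \<open>x' = x\<close> by (auto simp: wsection_def)
qed

text \<open>A vertical line holds at most two affine points of the curve, so away from
  \<open>Inf\<close> the line is \<open>y = l x + m\<close>, and substitution gives a cubic with
  three distinct roots. That these roots are simple yields the nonsingularity of points only assumed
  to lie on the curve.\<close>

lemma collinear_imp_wsection:
  assumes line: "u \<noteq> 0 \<or> v \<noteq> 0 \<or> w \<noteq> 0" "on_wline u v w P" "on_wline u v w Q" "on_wline u v w R"
    and dist: "P \<noteq> Q" "P \<noteq> R" "Q \<noteq> R" and on: "on_wcurve P" "on_wcurve Q" "on_wcurve R"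
  shows "nonsing P \<and> nonsing Q \<and> nonsing R \<and> wsection {#P, Q, R#}"
proof -
  consider "P = Inf" | "Q = Inf" | "R = Inf" | "P \<noteq> Inf" "Q \<noteq> Inf" "R \<noteq> Inf" by blast
  then show ?thesis
  proof cases
    case 1
    then show ?thesis using collinear_Inf[of u v w Q R] assms by simp
  next
    case 2
    then show ?thesis using collinear_Inf[of u v w P R] assms by (simp add: add_mset_commute)
  next
    case 3
    then show ?thesis using collinear_Inf[of u v w P Q] assms by (simp add: add_mset_commute)
  next
    case 4
    then obtain x1 y1 x2 y2 x3 y3 where eq: "P = Aff x1 y1" "Q = Aff x2 y2" "R = Aff x3 y3"
      by (metis wpoint.exhaust)
    have "v \<noteq> 0"
    proof
      assume v: "v = 0"
      then have "u * x1 + w = 0" "u * x2 + w = 0" "u * x3 + w = 0" using line eq by auto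
      moreover from this have "u * x1 = u * x2" "u * x1 = u * x3" by linarith+
      moreover from calculation have "u \<noteq> 0" using line(1) v by (cases "u = 0") auto
      ultimately have "x2 = x1" "x3 = x1" by auto
      moreover from this have "y2\<^sup>2 = y1\<^sup>2" "y3\<^sup>2 = y1\<^sup>2" using on eq by auto
      ultimately show False using dist eq by (auto simp: power2_eq_iff)
    qed
    define l m where "l = - u / v" and "m = - w / v"
    have y: "y1 = l * x1 + m" "y2 = l * x2 + m" "y3 = l * x3 + m"
      using line eq \<open>v \<noteq> 0\<close> by (auto simp: l_def m_def field_simps eq_neg_iff_add_eq_0)
    have x: "x1 \<noteq> x2" "x1 \<noteq> x3" "x2 \<noteq> x3" using dist eq y by auto
    have root: "poly (f - [:m, l:]\<^sup>2) x1 = 0" "poly (f - [:m, l:]\<^sup>2) x2 = 0"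
      "poly (f - [:m, l:]\<^sup>2) x3 = 0"
      using on eq y by (simp_all add: algebra_simps)
    then obtain q where q: "f - [:m, l:]\<^sup>2 = [:- x1, 1:] * q"
      by (auto simp only: poly_eq_0_iff_dvd dvd_def)
    have "poly q x2 = 0" using root(2) x unfolding q by simp
    then obtain x4 where x4: "f - [:m, l:]\<^sup>2 = [:- x1, 1:] * [:- x2, 1:] * [:- x4, 1:]"
      using monic_cubic_factor[OF monic_line_diff q] by blast
    have "x4 = x3" using root(3) x unfolding x4 poly_mult by simp
    with x4 have fact: "f - [:m, l:]\<^sup>2 = [:- x1, 1:] * [:- x2, 1:] * [:- x3, 1:]" by simp
    then have fact': "f - [:m, l:]\<^sup>2 = [:- x2, 1:] * [:- x3, 1:] * [:- x1, 1:]"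
      "f - [:m, l:]\<^sup>2 = [:- x1, 1:] * [:- x3, 1:] * [:- x2, 1:]"
      by (simp_all only: mult_ac)
    have "nonsing R" "nonsing P" "nonsing Q"
      using nonsing_third[OF fact] nonsing_third[OF fact'(1)] nonsing_third[OF fact'(2)] x eq y
      by auto
    moreover have "wsection {#P, Q, R#}"
      unfolding wsection_def line_triple_def using fact eq y by blast
    ultimately show ?thesis by blast
  qed
qed

end

section \<open>Cubic forms and intersection multiplicities\<close>

text \<open>The gradient at \<open>v\<close> applied to \<open>w\<close>; for a cubic form it is the
  coefficient of \<open>t\<close> in \<open>F (v + t w)\<close>, linear in \<open>w\<close> and
  quadratic in \<open>v\<close>.\<close>

definition dir_deriv :: "poly3 \<Rightarrow> real ^ 3 \<Rightarrow> real ^ 3 \<Rightarrow> real" where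
  "dir_deriv F v w = eval3 (deriv_X F) v * w $ 1 + eval3 (deriv_Y F) v * w $ 2
     + eval3 (deriv_Z F) v * w $ 3"

lemma cubic_form_explicit:
  assumes "homogeneous3 3 F"
  obtains a b c d e g h i j k where
    "F = [:[:[:0, 0, 0, a:], [:0, 0, b:], [:0, c:], [:d:]:], [:[:0, 0, e:], [:0, g:], [:h:]:],
      [:[:0, i:], [:j:]:], [:[:k:]:]:]"
proof -
  have 0: "coeff (coeff (coeff F k) j) i = 0" if "i + j + k \<noteq> 3" for i j k
    using assms that unfolding homogeneous3_def coeff3_def by blast
  let ?c = "\<lambda>i j k. coeff (coeff (coeff F k) j) i"
  have "F = [:[:[:0, 0, 0, ?c 3 0 0:], [:0, 0, ?c 2 1 0:], [:0, ?c 1 2 0:], [:?c 0 3 0:]:],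
      [:[:0, 0, ?c 2 0 1:], [:0, ?c 1 1 1:], [:?c 0 2 1:]:],
      [:[:0, ?c 1 0 2:], [:?c 0 1 2:]:], [:[:?c 0 0 3:]:]:]"
    by (intro poly_eqI) (auto simp: coeff_pCons 0 numeral_eq_Suc split: nat.split)
  then show ?thesis by (rule that)
qed

text \<open>Exchanging \<open>v\<close> and \<open>w\<close> reverses the coefficients, so the
  coefficient of \<open>t\<^sup>2\<close> is again a directional derivative.\<close>

lemma restrict_line_expand:
  assumes "homogeneous3 3 F"
  shows "restrict_line F v w = [:eval3 F v, dir_deriv F v w, dir_deriv F w v, eval3 F w:]"
proof -
  obtain a b c d e g h i j k where
    F: "F = [:[:[:0, 0, 0, a:], [:0, 0, b:], [:0, c:], [:d:]:], [:[:0, 0, e:], [:0, g:], [:h:]:],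
      [:[:0, i:], [:j:]:], [:[:k:]:]:]"
    using cubic_form_explicit[OF assms] .
  show ?thesis
    unfolding F restrict_line_def dir_deriv_def eval3_def deriv_X_def deriv_Y_def deriv_Z_def
    by (simp add: map_poly_pCons pcompose_pCons pderiv_pCons algebra_simps)
qed

lemma poly_restrict_line:
  assumes "homogeneous3 3 F"
  shows "poly (restrict_line F v w) t = eval3 F (v + t *\<^sub>R w)"
proof -
  obtain a b c d e g h i j k where
    F: "F = [:[:[:0, 0, 0, a:], [:0, 0, b:], [:0, c:], [:d:]:], [:[:0, 0, e:], [:0, g:], [:h:]:],
      [:[:0, i:], [:j:]:], [:[:k:]:]:]"
    using cubic_form_explicit[OF assms] .
  show ?thesis
    unfolding F restrict_line_def eval3_def
    by (simp add: map_poly_pCons pcompose_pCons algebra_simps)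
qed

lemma eval3_scaleR:
  assumes "homogeneous3 3 F"
  shows "eval3 F (s *\<^sub>R v) = s ^ 3 * eval3 F v"
proof -
  obtain a b c d e g h i j k where
    F: "F = [:[:[:0, 0, 0, a:], [:0, 0, b:], [:0, c:], [:d:]:], [:[:0, 0, e:], [:0, g:], [:h:]:],
      [:[:0, i:], [:j:]:], [:[:k:]:]:]"
    using cubic_form_explicit[OF assms] .
  show ?thesis
    unfolding F eval3_def by (simp add: algebra_simps power3_eq_cube)
qed

lemma dir_deriv_scaleR_left:
  assumes "homogeneous3 3 F"
  shows "dir_deriv F (s *\<^sub>R v) w = s\<^sup>2 * dir_deriv F v w"
proof -
  obtain a b c d e g h i j k where
    F: "F = [:[:[:0, 0, 0, a:], [:0, 0, b:], [:0, c:], [:d:]:], [:[:0, 0, e:], [:0, g:], [:h:]:],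
      [:[:0, i:], [:j:]:], [:[:k:]:]:]"
    using cubic_form_explicit[OF assms] .
  show ?thesis
    unfolding F dir_deriv_def eval3_def deriv_X_def deriv_Y_def deriv_Z_def
    by (simp add: map_poly_pCons pderiv_pCons algebra_simps power2_eq_square)
qed

lemma dir_deriv_add: "dir_deriv F v (w + w') = dir_deriv F v w + dir_deriv F v w'"
  and dir_deriv_scaleR: "dir_deriv F v (s *\<^sub>R w) = s * dir_deriv F v w"
  by (simp_all add: dir_deriv_def algebra_simps)

lemma dir_deriv_self:
  assumes "homogeneous3 3 F"
  shows "dir_deriv F v v = 3 * eval3 F v"
proof -
  obtain a b c d e g h i j k where
    F: "F = [:[:[:0, 0, 0, a:], [:0, 0, b:], [:0, c:], [:d:]:], [:[:0, 0, e:], [:0, g:], [:h:]:],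
      [:[:0, i:], [:j:]:], [:[:k:]:]:]"
    using cubic_form_explicit[OF assms] .
  show ?thesis
    unfolding F dir_deriv_def eval3_def deriv_X_def deriv_Y_def deriv_Z_def
    by (simp add: map_poly_pCons pderiv_pCons algebra_simps)
qed

lemma dir_deriv_quadratic:
  assumes "homogeneous3 3 F"
  shows "dir_deriv F (x *\<^sub>R p + y *\<^sub>R q) r = x\<^sup>2 * dir_deriv F p r
    + x * y * (dir_deriv F (p + q) r - dir_deriv F p r - dir_deriv F q r) + y\<^sup>2 * dir_deriv F q r"
proof -
  obtain a b c d e g h i j k where
    F: "F = [:[:[:0, 0, 0, a:], [:0, 0, b:], [:0, c:], [:d:]:], [:[:0, 0, e:], [:0, g:], [:h:]:],
      [:[:0, i:], [:j:]:], [:[:k:]:]:]"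
    using cubic_form_explicit[OF assms] .
  show ?thesis
    unfolding F dir_deriv_def eval3_def deriv_X_def deriv_Y_def deriv_Z_def
    by (simp add: map_poly_pCons pderiv_pCons power2_eq_square algebra_simps)
qed

lemma eval3_add:
  assumes "homogeneous3 3 F"
  shows "eval3 F (v + w) = eval3 F v + dir_deriv F v w + dir_deriv F w v + eval3 F w"
  using poly_restrict_line[OF assms, of v w 1] by (simp add: restrict_line_expand[OF assms])

lemma cubic_in_basis:
  assumes "homogeneous3 3 F"
  obtains g where
    "\<And>x y z. eval3 F (x *\<^sub>R p + y *\<^sub>R q + z *\<^sub>R r) =
      eval3 F p * x ^ 3 + dir_deriv F p q * x\<^sup>2 * y + dir_deriv F q p * x * y\<^sup>2 + eval3 F q * y ^ 3 +
      z * (dir_deriv F p r * x\<^sup>2 + g * x * y + dir_deriv F q r * y\<^sup>2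
        + dir_deriv F r p * x * z + dir_deriv F r q * y * z + eval3 F r * z\<^sup>2)"
proof
  fix x y z
  have "eval3 F (p + (q + r)) = eval3 F ((p + q) + r)" by (simp only: add.assoc)
  \<comment> \<open>The coefficient of \<open>x y z\<close> is written asymmetrically, as a
    polarization of the derivative in direction \<open>r\<close>. Comparing the two bracketings of
    \<open>p + q + r\<close> shows that direction \<open>p\<close> gives the same number.\<close>
  then have sym: "dir_deriv F (q + r) p = dir_deriv F q p + dir_deriv F r p
      + (dir_deriv F (p + q) r - dir_deriv F p r - dir_deriv F q r)"
    by (simp add: eval3_add[OF assms] dir_deriv_add)
  show "eval3 F (x *\<^sub>R p + y *\<^sub>R q + z *\<^sub>R r) =
      eval3 F p * x ^ 3 + dir_deriv F p q * x\<^sup>2 * y + dir_deriv F q p * x * y\<^sup>2 + eval3 F q * y ^ 3 +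
      z * (dir_deriv F p r * x\<^sup>2
        + (dir_deriv F (p + q) r - dir_deriv F p r - dir_deriv F q r) * x * y + dir_deriv F q r * y\<^sup>2
        + dir_deriv F r p * x * z + dir_deriv F r q * y * z + eval3 F r * z\<^sup>2)"
    by (simp add: eval3_add[OF assms] eval3_scaleR[OF assms] dir_deriv_quadratic[OF assms]
        dir_deriv_scaleR_left[OF assms] dir_deriv_scaleR dir_deriv_add sym algebra_simps
        power2_eq_square power3_eq_cube)
qed

lemma eval3_combination:
  assumes "homogeneous3 3 F"
  shows "eval3 F (x *\<^sub>R v + y *\<^sub>R w) = eval3 F v * x ^ 3 + dir_deriv F v w * x\<^sup>2 * y
    + dir_deriv F w v * x * y\<^sup>2 + eval3 F w * y ^ 3"
  by (simp add: eval3_add[OF assms] eval3_scaleR[OF assms]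
      dir_deriv_scaleR_left[OF assms] dir_deriv_scaleR)

lemma monom_dvd_cubic_iff:
  "monom 1 n dvd [:c0, c1, c2, c3 :: real:] \<longleftrightarrow>
    (0 < n \<longrightarrow> c0 = 0) \<and> (1 < n \<longrightarrow> c1 = 0) \<and> (2 < n \<longrightarrow> c2 = 0) \<and> (3 < n \<longrightarrow> c3 = 0)"
  unfolding monom_1_dvd_iff'
  by (auto simp: coeff_pCons numeral_eq_Suc split: nat.split)

text \<open>Only divisibility by powers is used, so zero polynomials are covered: there
  \<open>order\<close> is an unspecified value, but one that depends only on which powers
  divide.\<close>

lemma order_0_cong:
  fixes p q :: "real poly"
  assumes "\<And>n. monom 1 n dvd p \<longleftrightarrow> monom 1 n dvd q"
  shows "Polynomial.order 0 p = Polynomial.order 0 q"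
proof -
  have *: "[:- 0, 1:] ^ n = (monom 1 n :: real poly)" for n by (simp add: monom_altdef)
  show ?thesis unfolding Polynomial.order_def by (simp only: * assms)
qed

lemma coeff_below_order_0: "k < Polynomial.order 0 p \<Longrightarrow> coeff (p :: real poly) k = 0"
  using order_1[of 0 p] monom_1_dvd_iff'[of "Polynomial.order 0 p" p] by (simp add: monom_altdef)

text \<open>The change of vectors acts on the coefficients by a triangular matrix whose diagonal
  consists of products of powers of \<open>\<alpha>\<close> and \<open>\<beta>\<close>, so the first
  \<open>n\<close> coefficients vanish either for both polynomials or for neither.\<close>

lemma order_restrict_line_indep:
  assumes F: "homogeneous3 3 F" and ab: "\<alpha> \<noteq> 0" "\<beta> \<noteq> 0"
  shows "Polynomial.order 0 (restrict_line F (\<alpha> *\<^sub>R v) (\<beta> *\<^sub>R w + \<gamma> *\<^sub>R v)) =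
    Polynomial.order 0 (restrict_line F v w)"
proof (rule order_0_cong)
  fix n :: nat
  define c0 c1 c2 c3 where c: "c0 = eval3 F v" "c1 = dir_deriv F v w" "c2 = dir_deriv F w v"
    "c3 = eval3 F w"
  have "restrict_line F (\<alpha> *\<^sub>R v) (\<beta> *\<^sub>R w + \<gamma> *\<^sub>R v) =
    [:\<alpha> ^ 3 * c0, \<alpha>\<^sup>2 * (3 * \<gamma> * c0 + \<beta> * c1), \<alpha> * (3 * \<gamma>\<^sup>2 * c0 + 2 * \<gamma> * \<beta> * c1 + \<beta>\<^sup>2 * c2),
      \<gamma> ^ 3 * c0 + \<gamma>\<^sup>2 * \<beta> * c1 + \<gamma> * \<beta>\<^sup>2 * c2 + \<beta> ^ 3 * c3:]"
  proof (rule poly_eq_poly_eq_iff[THEN iffD1], rule ext)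
    fix t
    have "\<alpha> *\<^sub>R v + t *\<^sub>R (\<beta> *\<^sub>R w + \<gamma> *\<^sub>R v) = (\<alpha> + t * \<gamma>) *\<^sub>R v + (t * \<beta>) *\<^sub>R w"
      by (simp add: algebra_simps)
    then show "poly (restrict_line F (\<alpha> *\<^sub>R v) (\<beta> *\<^sub>R w + \<gamma> *\<^sub>R v)) t = poly
      [:\<alpha> ^ 3 * c0, \<alpha>\<^sup>2 * (3 * \<gamma> * c0 + \<beta> * c1), \<alpha> * (3 * \<gamma>\<^sup>2 * c0 + 2 * \<gamma> * \<beta> * c1 + \<beta>\<^sup>2 * c2),
        \<gamma> ^ 3 * c0 + \<gamma>\<^sup>2 * \<beta> * c1 + \<gamma> * \<beta>\<^sup>2 * c2 + \<beta> ^ 3 * c3:] t"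
      by (simp only: poly_restrict_line[OF F] eval3_combination[OF F] c[symmetric])
         (simp add: power2_eq_square power3_eq_cube algebra_simps)
  qed
  moreover have "n = 0 \<or> n = 1 \<or> n = 2 \<or> n = 3 \<or> 3 < n" by linarith
  ultimately show "monom 1 n dvd restrict_line F (\<alpha> *\<^sub>R v) (\<beta> *\<^sub>R w + \<gamma> *\<^sub>R v) \<longleftrightarrow>
      monom 1 n dvd restrict_line F v w"
    unfolding restrict_line_expand[OF F, of v w] c[symmetric]
    using ab by (elim disjE) (auto simp: monom_dvd_cubic_iff)
qed

section \<open>Points, lines and multiplicities through spanning vectors\<close>

lemma Rep_proj_point_eq_span:
  assumes "v \<in> Rep_proj_point P" "v \<noteq> 0"
  shows "Rep_proj_point P = span {v}"
proof -
  have P: "subspace (Rep_proj_point P)" "dim (Rep_proj_point P) = 1" using Rep_proj_point by auto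
  have "span {v} = Rep_proj_point P"
  proof (rule subspace_dim_equal)
    show "span {v} \<subseteq> Rep_proj_point P" using assms P span_minimal by blast
    show "dim (Rep_proj_point P) \<le> dim (span {v})" using P assms by (simp add: dim_insert)
  qed (use P in auto)
  then show ?thesis by simp
qed

lemma Rep_proj_line_eq_span:
  assumes "v \<in> Rep_proj_line l" "w \<in> Rep_proj_line l" "v \<noteq> 0" "w \<notin> span {v}"
  shows "Rep_proj_line l = span {w, v}"
proof -
  have l: "subspace (Rep_proj_line l)" "dim (Rep_proj_line l) = 2" using Rep_proj_line by auto
  have "span {w, v} = Rep_proj_line l"
  proof (rule subspace_dim_equal)
    show "span {w, v} \<subseteq> Rep_proj_line l" using assms l span_minimal[of "{w, v}"] by simp
    show "dim (Rep_proj_line l) \<le> dim (span {w, v})" using l assms by (simp add: dim_insert)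
  qed (use l in auto)
  then show ?thesis by simp
qed

lemma proj_point_nonzero: obtains v where "v \<in> Rep_proj_point P" "v \<noteq> 0"
proof -
  have "dim (Rep_proj_point P) \<noteq> 0" using Rep_proj_point[of P] by auto
  then show ?thesis using that by (auto simp: dim_eq_0)
qed

lemma proj_line_off_point: obtains w where "w \<in> Rep_proj_line l" "w \<notin> Rep_proj_point P"
proof -
  have "\<not> Rep_proj_line l \<subseteq> Rep_proj_point P"
    using dim_subset[of "Rep_proj_line l" "Rep_proj_point P"] Rep_proj_point[of P]
      Rep_proj_line[of l] by auto
  then show ?thesis using that by blast
qed

lemma span_pair: "x \<in> span {w, v} \<longleftrightarrow> (\<exists>s t. x = s *\<^sub>R w + t *\<^sub>R (v :: 'a::real_vector))"
  unfolding span_insert span_singleton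
  by (auto simp: algebra_simps)

text \<open>Any other admissible vectors are \<open>\<alpha> *\<^sub>R v\<close> and
  \<open>\<beta> *\<^sub>R w + \<gamma> *\<^sub>R v\<close> with nonzero \<open>\<alpha>\<close> and
  \<open>\<beta>\<close>, so the definite description denotes and one choice of vectors computes
  it.\<close>

lemma intersection_mult_eq_order:
  assumes F: "homogeneous3 3 F" and "on_line P l"
    and v: "v \<in> Rep_proj_point P" "v \<noteq> 0" and w: "w \<in> Rep_proj_line l" "w \<notin> Rep_proj_point P"
  shows "intersection_mult F l P = Polynomial.order 0 (restrict_line F v w)"
proof -
  have P: "Rep_proj_point P = span {v}" by (rule Rep_proj_point_eq_span[OF v])
  have "v \<in> Rep_proj_line l" using assms by (auto simp: on_line_def)
  then have l: "Rep_proj_line l = span {w, v}"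
    using v w P by (intro Rep_proj_line_eq_span) auto
  have "Polynomial.order 0 (restrict_line F v' w') = Polynomial.order 0 (restrict_line F v w)"
    if v': "v' \<in> Rep_proj_point P" "v' \<noteq> 0"
      and w': "w' \<in> Rep_proj_line l" "w' \<notin> Rep_proj_point P" for v' w'
  proof -
    obtain \<alpha> where \<alpha>: "v' = \<alpha> *\<^sub>R v" using v' P by (auto simp: span_singleton)
    obtain \<beta> \<gamma> where \<beta>: "w' = \<beta> *\<^sub>R w + \<gamma> *\<^sub>R v" using w' l by (auto simp: span_pair)
    have "\<alpha> \<noteq> 0" using v' \<alpha> by auto
    moreover have "\<beta> \<noteq> 0" using w' \<beta> P by (auto simp: span_singleton)
    ultimately show ?thesis unfolding \<alpha> \<beta> by (rule order_restrict_line_indep[OF F])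
  qed
  then have "(THE m. \<forall>v w. v \<in> Rep_proj_point P \<longrightarrow> v \<noteq> 0 \<longrightarrow> w \<in> Rep_proj_line l \<longrightarrow>
      w \<notin> Rep_proj_point P \<longrightarrow> Polynomial.order 0 (restrict_line F v w) = m) =
    Polynomial.order 0 (restrict_line F v w)"
    by (intro the_equality) (use v w in blast)+
  then show ?thesis
    unfolding intersection_mult_def using \<open>on_line P l\<close> by simp
qed

lemma proj_lines_eq:
  assumes "P \<noteq> Q" "on_line P l" "on_line Q l" "on_line P l'" "on_line Q l'"
  shows "l = l'"
proof -
  obtain v w where v: "v \<in> Rep_proj_point P" "v \<noteq> 0" and w: "w \<in> Rep_proj_point Q" "w \<noteq> 0"
    by (meson proj_point_nonzero)
  have "w \<notin> span {v}"
  proof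
    assume "w \<in> span {v}"
    then have "w \<in> Rep_proj_point P" using Rep_proj_point_eq_span[OF v] by simp
    then have "Rep_proj_point P = Rep_proj_point Q"
      using Rep_proj_point_eq_span w by blast
    then show False using assms(1) by (simp add: Rep_proj_point_inject)
  qed
  then have "Rep_proj_line l = Rep_proj_line l'"
    using Rep_proj_line_eq_span[of v l w] Rep_proj_line_eq_span[of v l' w] assms v w
    unfolding on_line_def by blast
  then show ?thesis by (simp add: Rep_proj_line_inject)
qed

lemma nonsingular_points_iff:
  assumes F: "homogeneous3 3 F" and v: "v \<in> Rep_proj_point P" "v \<noteq> 0"
  shows "P \<in> nonsingular_points F \<longleftrightarrow> P \<in> curve_points F \<and> (\<exists>w. dir_deriv F v w \<noteq> 0)"
proof -
  have *: "(\<exists>w. dir_deriv F u w \<noteq> 0) \<longleftrightarrow> eval3 (deriv_X F) u \<noteq> 0 \<or> eval3 (deriv_Y F) u \<noteq> 0 \<or>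
      eval3 (deriv_Z F) u \<noteq> 0" (is "?L \<longleftrightarrow> ?R") for u
  proof
    show "?L \<Longrightarrow> ?R" by (auto simp: dir_deriv_def)
    have "dir_deriv F u (axis 1 1) = eval3 (deriv_X F) u" "dir_deriv F u (axis 2 1) = eval3 (deriv_Y F) u"
      "dir_deriv F u (axis 3 1) = eval3 (deriv_Z F) u"
      by (simp_all add: dir_deriv_def axis_def)
    then show "?R \<Longrightarrow> ?L" by metis
  qed
  have "(\<exists>w. dir_deriv F u w \<noteq> 0) \<longleftrightarrow> (\<exists>w. dir_deriv F v w \<noteq> 0)"
    if u: "u \<in> Rep_proj_point P" "u \<noteq> 0" for u
  proof -
    obtain s where "u = s *\<^sub>R v"
      using u Rep_proj_point_eq_span[OF v] by (auto simp: span_singleton)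
    then show ?thesis using u by (auto simp: dir_deriv_scaleR_left[OF F])
  qed
  then show ?thesis
    unfolding nonsingular_points_def mem_Collect_eq *[symmetric] using v by blast
qed

text \<open>A double intersection kills the linear coefficient, so the plane of the line lies in the
  kernel of the gradient, which at a nonsingular point has dimension at most two.\<close>

lemma tangent_unique:
  assumes F: "homogeneous3 3 F" and P: "P \<in> nonsingular_points F"
    and l: "intersection_mult F l P \<ge> 2" "intersection_mult F l' P \<ge> 2"
  shows "l = l'"
proof -
  obtain v where v: "v \<in> Rep_proj_point P" "v \<noteq> 0" by (rule proj_point_nonzero)
  define K where "K = {w. dir_deriv F v w = 0}"
  have K: "subspace K"
    by (auto simp: K_def subspace_def dir_deriv_add dir_deriv_scaleR) (simp add: dir_deriv_def)
  have Pc: "P \<in> curve_points F" and "\<exists>w. dir_deriv F v w \<noteq> 0"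
    using nonsingular_points_iff[OF F v] P by auto
  then have "K \<noteq> UNIV" by (auto simp: K_def)
  moreover have spK: "span K = K" using K by (simp only: span_eq_iff)
  ultimately have "dim K \<noteq> 3" using dim_eq_full[of K] unfolding spK by simp
  moreover have "dim K \<le> 3" using dim_subset_UNIV[of K] by simp
  ultimately have dK: "dim K \<le> 2" by simp
  have "Rep_proj_line m = K" if m: "intersection_mult F m P \<ge> 2" for m
  proof (rule subspace_dim_equal)
    have on: "on_line P m" using m by (auto simp: intersection_mult_def split: if_splits)
    show "Rep_proj_line m \<subseteq> K"
    proof
      fix w assume w: "w \<in> Rep_proj_line m"
      show "w \<in> K"
      proof (cases "w \<in> Rep_proj_point P")
        case True
        then obtain s where "w = s *\<^sub>R v"
          using Rep_proj_point_eq_span[OF v] by (auto simp: span_singleton)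
        then show ?thesis
          using Pc v by (auto simp: K_def dir_deriv_scaleR dir_deriv_self[OF F] curve_points_def)
      next
        case False
        have "coeff (restrict_line F v w) 1 = 0"
          using m intersection_mult_eq_order[OF F on v w False] by (intro coeff_below_order_0) simp
        then show ?thesis by (simp add: restrict_line_expand[OF F] K_def)
      qed
    qed
  qed (use K dK Rep_proj_line[of m] in auto)
  then have "Rep_proj_line l = Rep_proj_line l'" using l by simp
  then show ?thesis by (simp add: Rep_proj_line_inject)
qed

text \<open>Two of the points determine the line, as a chord or as the tangent at the nonsingular
  \<open>A\<close>; the multiplicities on that line then determine the whole multiset.\<close>

lemma third_point_eqI:
  assumes F: "homogeneous3 3 F" and A: "A \<in> nonsingular_points F"
    and l: "line_section F l {#A, B, C#}"
  shows "third_point F A B = C"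
  unfolding third_point_def
proof (rule the_equality)
  show "\<exists>l. line_section F l {#A, B, C#}" using l by blast
  fix D assume "\<exists>l. line_section F l {#A, B, D#}"
  then obtain l' where l': "line_section F l' {#A, B, D#}" by blast
  have on: "on_line P m" if "line_section F m M" "P \<in># M" for P m M
  proof -
    have "intersection_mult F m P \<noteq> 0"
      using that by (simp add: line_section_def flip: count_greater_zero_iff)
    then show ?thesis by (auto simp: intersection_mult_def split: if_splits)
  qed
  have "l = l'"
  proof (cases "A = B")
    case True
    have "intersection_mult F l A \<ge> 2" "intersection_mult F l' A \<ge> 2"
      using l[unfolded line_section_def, rule_format, of A, symmetric]
        l'[unfolded line_section_def, rule_format, of A, symmetric] True by simp_all
    then show ?thesis using tangent_unique[OF F A] by blast
  next
    case False
    then show ?thesis using on[OF l] on[OF l'] by (intro proj_lines_eq[of A B]) auto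
  qed
  then have "{#A, B, D#} = {#A, B, C#}"
    using l l' unfolding line_section_def by (intro multiset_eqI) simp
  then show "D = C" by simp
qed

section \<open>The group of a cubic in Weierstrass coordinates\<close>

text \<open>The numbers \<open>x\<close>, \<open>y\<close>, \<open>z\<close> are coordinates in the
  basis \<open>p\<close>, \<open>q\<close>, \<open>r\<close>. Since \<open>q\<close> spans
  \<open>e\<close>, the inflection point is \<open>(0 : 1 : 0)\<close>, the only point of the curve
  with \<open>z = 0\<close>.\<close>

locale weierstrass_cubic = weierstrass +
  fixes F :: poly3 and e :: proj_point and p q r :: "real ^ 3" and k :: real
  assumes hom: "homogeneous3 3 F" and k: "k \<noteq> 0"
    and form: "eval3 F (x *\<^sub>R p + y *\<^sub>R q + z *\<^sub>R r) =
      k * (x ^ 3 + a2 * x\<^sup>2 * z + a4 * x * z\<^sup>2 + a6 * z ^ 3 - y\<^sup>2 * z)"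
    and indep: "x *\<^sub>R p + y *\<^sub>R q + z *\<^sub>R r = 0 \<Longrightarrow> x = 0 \<and> y = 0 \<and> z = 0"
    and basis: "\<exists>x y z. v = x *\<^sub>R p + y *\<^sub>R q + z *\<^sub>R r"
    and Rep_e: "Rep_proj_point e = span {q}"
begin

definition vec :: "real \<Rightarrow> real \<Rightarrow> real \<Rightarrow> real ^ 3" where
  "vec x y z = x *\<^sub>R p + y *\<^sub>R q + z *\<^sub>R r"

lemma eval3_vec:
  "eval3 F (vec x y z) = k * (x ^ 3 + a2 * x\<^sup>2 * z + a4 * x * z\<^sup>2 + a6 * z ^ 3 - y\<^sup>2 * z)"
  unfolding vec_def by (rule form)

lemma vec_add: "vec x y z + vec x' y' z' = vec (x + x') (y + y') (z + z')"
  and vec_scaleR: "s *\<^sub>R vec x y z = vec (s * x) (s * y) (s * z)"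
  by (simp_all add: vec_def algebra_simps)

lemma vec_eq_iff: "vec x y z = vec x' y' z' \<longleftrightarrow> x = x' \<and> y = y' \<and> z = z'"
proof
  assume "vec x y z = vec x' y' z'"
  then have "(x - x') *\<^sub>R p + (y - y') *\<^sub>R q + (z - z') *\<^sub>R r = 0"
    by (simp add: vec_def algebra_simps)
  from indep[OF this] show "x = x' \<and> y = y' \<and> z = z'" by simp
qed simp

lemma vec_0: "0 = vec 0 0 0" by (simp add: vec_def)

lemma vec_cases: obtains x y z where "v = vec x y z"
  using basis[of v] unfolding vec_def by blast

definition point :: "real ^ 3 \<Rightarrow> proj_point" where
  "point v = Abs_proj_point (span {v})"

lemma Rep_point: "v \<noteq> 0 \<Longrightarrow> Rep_proj_point (point v) = span {v}"
  unfolding point_def by (rule Abs_proj_point_inverse) (simp add: dim_insert)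

lemma point_eqI: "v \<in> Rep_proj_point A \<Longrightarrow> v \<noteq> 0 \<Longrightarrow> A = point v"
  using Rep_proj_point_eq_span[of v A] by (simp add: Rep_point flip: Rep_proj_point_inject)

fun coords :: "wpoint \<Rightarrow> real ^ 3" where
  "coords Inf = vec 0 1 0"
| "coords (Aff x y) = vec x y 1"

definition pt :: "wpoint \<Rightarrow> proj_point" where
  "pt P = point (coords P)"

lemma coords_nz: "coords P \<noteq> 0"
  by (cases P) (simp_all add: vec_0 vec_eq_iff)

lemma Rep_pt: "Rep_proj_point (pt P) = span {coords P}"
  unfolding pt_def by (rule Rep_point[OF coords_nz])

lemma coords_in_pt: "coords P \<in> Rep_proj_point (pt P)"
  by (simp add: Rep_pt span_base)

lemma pt_Inf: "pt Inf = e"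
  using Rep_pt[of Inf] Rep_e by (simp add: vec_def flip: Rep_proj_point_inject)

lemma pt_inject: "pt P = pt Q \<longleftrightarrow> P = Q"
proof
  assume "pt P = pt Q"
  then have "coords P \<in> span {coords Q}" using coords_in_pt[of P] by (simp add: Rep_pt)
  then obtain s where "coords P = s *\<^sub>R coords Q" by (auto simp: span_singleton)
  then show "P = Q" by (cases P; cases Q) (auto simp: vec_scaleR vec_eq_iff)
qed simp

lemma pt_Aff_eqI:
  assumes "vec x y z \<in> Rep_proj_point A" "z \<noteq> 0"
  shows "A = pt (Aff (x / z) (y / z))"
proof -
  have "(1 / z) *\<^sub>R vec x y z \<in> Rep_proj_point A"
    using assms Rep_proj_point[of A] by (intro subspace_scale) auto
  then have "coords (Aff (x / z) (y / z)) \<in> Rep_proj_point A" using assms(2) by (simp add: vec_scaleR)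
  then show ?thesis unfolding pt_def by (rule point_eqI[OF _ coords_nz])
qed

lemma pt_Inf_eqI:
  assumes "vec 0 y 0 \<in> Rep_proj_point A" "y \<noteq> 0"
  shows "A = pt Inf"
proof -
  have "(1 / y) *\<^sub>R vec 0 y 0 \<in> Rep_proj_point A"
    using assms Rep_proj_point[of A] by (intro subspace_scale) auto
  then have "coords Inf \<in> Rep_proj_point A" using assms(2) by (simp add: vec_scaleR)
  then show ?thesis unfolding pt_def by (rule point_eqI[OF _ coords_nz])
qed

lemma eval3_coords: "eval3 F (coords P) = 0 \<longleftrightarrow> on_wcurve P"
proof (cases P)
  case (Aff x y)
  have "eval3 F (coords P) = k * (poly f x - y\<^sup>2)"
    by (simp add: Aff eval3_vec f_def algebra_simps power2_eq_square power3_eq_cube)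
  then show ?thesis using k Aff by auto
qed (simp add: eval3_vec)

lemma pt_curve_iff: "pt P \<in> curve_points F \<longleftrightarrow> on_wcurve P"
proof
  assume "pt P \<in> curve_points F"
  then show "on_wcurve P" using coords_in_pt eval3_coords by (auto simp: curve_points_def)
next
  assume "on_wcurve P"
  then have "eval3 F (s *\<^sub>R coords P) = 0" for s by (simp add: eval3_scaleR[OF hom] eval3_coords)
  then show "pt P \<in> curve_points F"
    by (auto simp: curve_points_def Rep_pt span_singleton)
qed

lemma curve_point_cases:
  assumes "A \<in> curve_points F"
  obtains P where "on_wcurve P" "A = pt P"
proof -
  obtain v where v: "v \<in> Rep_proj_point A" "v \<noteq> 0" by (rule proj_point_nonzero)
  obtain x y z where xyz: "v = vec x y z" by (rule vec_cases)
  have "\<exists>P. A = pt P"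
  proof (cases "z = 0")
    case False
    then show ?thesis using pt_Aff_eqI v xyz by blast
  next
    case True
    have "eval3 F v = 0" using assms v by (auto simp: curve_points_def)
    then have "x = 0" using True xyz k by (simp add: eval3_vec)
    moreover from this have "y \<noteq> 0" using v xyz True by (auto simp: vec_0)
    ultimately show ?thesis using pt_Inf_eqI v xyz True by blast
  qed
  then show ?thesis using assms that pt_curve_iff by blast
qed

text \<open>Derivatives are read off from the restricted polynomial, which avoids transforming the
  partial derivatives to the new basis.\<close>

lemma dir_deriv_eqI:
  assumes "\<And>t. eval3 F (v + t *\<^sub>R w) = poly g t"
  shows "dir_deriv F v w = coeff g 1"
proof -
  have "restrict_line F v w = g"
    by (rule poly_eq_poly_eq_iff[THEN iffD1], rule ext) (simp add: poly_restrict_line[OF hom] assms)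
  then show ?thesis by (auto simp: restrict_line_expand[OF hom])
qed

text \<open>At an affine point of the curve the derivatives along \<open>p\<close> and
  \<open>q\<close> are multiples of \<open>poly (pderiv f) x\<close> and \<open>y\<close>, and
  Euler's identity makes the one along \<open>r\<close> a combination of these. At infinity the
  derivative along \<open>r\<close> is \<open>- k\<close>.\<close>

lemma pt_nonsingular_iff:
  "pt P \<in> nonsingular_points F \<longleftrightarrow> nonsing P"
proof (cases P)
  case Inf
  have "dir_deriv F (coords Inf) (vec 0 0 1) = coeff [:0, - k, 0, k * a6:] 1"
    by (rule dir_deriv_eqI)
       (simp add: vec_scaleR vec_add eval3_vec power3_eq_cube algebra_simps)
  then have "dir_deriv F (coords Inf) (vec 0 0 1) \<noteq> 0" using k by simp
  then show ?thesis
    using Inf nonsingular_points_iff[OF hom coords_in_pt coords_nz, of Inf] pt_curve_iff[of Inf]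
    by auto
next
  case (Aff x y)
  have "dir_deriv F (vec x y 1) p = coeff [:k * (poly f x - y\<^sup>2), k * poly (pderiv f) x,
      k * (3 * x + a2), k:] 1"
  proof (rule dir_deriv_eqI)
    fix t
    have "vec x y 1 + t *\<^sub>R p = vec (x + t) y 1" by (simp add: vec_def algebra_simps)
    then show "eval3 F (vec x y 1 + t *\<^sub>R p) = poly [:k * (poly f x - y\<^sup>2), k * poly (pderiv f) x,
      k * (3 * x + a2), k:] t"
      by (simp add: eval3_vec f_def pderiv_pCons power2_eq_square power3_eq_cube algebra_simps)
  qed
  then have dp: "dir_deriv F (vec x y 1) p = k * poly (pderiv f) x" by simp
  have "dir_deriv F (vec x y 1) q = coeff [:k * (poly f x - y\<^sup>2), - 2 * k * y, - k:] 1"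
  proof (rule dir_deriv_eqI)
    fix t
    have "vec x y 1 + t *\<^sub>R q = vec x (y + t) 1" by (simp add: vec_def algebra_simps)
    then show "eval3 F (vec x y 1 + t *\<^sub>R q) = poly [:k * (poly f x - y\<^sup>2), - 2 * k * y, - k:] t"
      by (simp add: eval3_vec f_def power2_eq_square power3_eq_cube algebra_simps)
  qed
  then have dq: "dir_deriv F (vec x y 1) q = - 2 * k * y" by simp
  have "(\<exists>w. dir_deriv F (vec x y 1) w \<noteq> 0) \<longleftrightarrow> y \<noteq> 0 \<or> poly (pderiv f) x \<noteq> 0"
    if on: "y\<^sup>2 = poly f x"
  proof
    assume "y \<noteq> 0 \<or> poly (pderiv f) x \<noteq> 0"
    then have "dir_deriv F (vec x y 1) q \<noteq> 0 \<or> dir_deriv F (vec x y 1) p \<noteq> 0"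
      using dp dq k by auto
    then show "\<exists>w. dir_deriv F (vec x y 1) w \<noteq> 0" by blast
  next
    assume "\<exists>w. dir_deriv F (vec x y 1) w \<noteq> 0"
    then obtain w where w: "dir_deriv F (vec x y 1) w \<noteq> 0" by blast
    show "y \<noteq> 0 \<or> poly (pderiv f) x \<noteq> 0"
    proof (rule ccontr)
      assume "\<not> ?thesis"
      then have 0: "dir_deriv F (vec x y 1) p = 0" "dir_deriv F (vec x y 1) q = 0"
        using dp dq by auto
      have "dir_deriv F (vec x y 1) (vec x y 1) = 0"
        using eval3_coords[of "Aff x y"] on by (simp add: dir_deriv_self[OF hom])
      moreover have "vec x y 1 = x *\<^sub>R p + y *\<^sub>R q + r" by (simp add: vec_def)
      ultimately have "dir_deriv F (vec x y 1) r = 0"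
        using 0 by (metis dir_deriv_add dir_deriv_scaleR add_0 mult_zero_right)
      moreover obtain a b c where "w = a *\<^sub>R p + b *\<^sub>R q + c *\<^sub>R r" using basis by blast
      ultimately show False using 0 w by (simp add: dir_deriv_add dir_deriv_scaleR)
    qed
  qed
  then show ?thesis
    using nonsingular_points_iff[OF hom coords_in_pt coords_nz, of P] pt_curve_iff[of P] Aff by auto
qed

section \<open>Line sections with multiplicities in the projective plane\<close>

definition line :: "real ^ 3 \<Rightarrow> real ^ 3 \<Rightarrow> proj_line" where
  "line v w = Abs_proj_line (span {v, w})"

lemma Rep_line: "w \<noteq> 0 \<Longrightarrow> v \<notin> span {w} \<Longrightarrow> Rep_proj_line (line v w) = span {v, w}"
  unfolding line_def by (rule Abs_proj_line_inverse) (simp add: dim_insert)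

lemma intersection_mult_eqI:
  assumes "on_line A l" "v \<in> Rep_proj_point A" "v \<noteq> 0" "w \<in> Rep_proj_line l" "w \<notin> span {v}"
    and "\<And>t. eval3 F (v + t *\<^sub>R w) = poly g t"
  shows "intersection_mult F l A = Polynomial.order 0 g"
proof -
  have "restrict_line F v w = g"
    by (rule poly_eq_poly_eq_iff[THEN iffD1], rule ext) (simp add: poly_restrict_line[OF hom] assms(6))
  then show ?thesis
    using intersection_mult_eq_order[OF hom assms(1-4)] assms(5) Rep_proj_point_eq_span[OF assms(2,3)]
    by simp
qed

lemma order_0_linear: "Polynomial.order 0 [:a, 1 :: real:] = (if a = 0 then 1 else 0)"
  using order_power_n_n[of "0 :: real" 1] by (auto intro: order_0I)

lemma line_sectionI:
  assumes "v \<noteq> 0" "u \<notin> span {v}"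
    and mult: "\<And>A. on_line A (line u v) \<Longrightarrow> count M A = intersection_mult F (line u v) A"
    and on: "\<And>A. A \<in># M \<Longrightarrow> on_line A (line u v)"
  shows "line_section F (line u v) M"
  unfolding line_section_def
proof
  fix A
  show "count M A = intersection_mult F (line u v) A"
  proof (cases "on_line A (line u v)")
    case False
    then have "A \<notin># M" using on by blast
    then show ?thesis using False by (simp add: intersection_mult_def not_in_iff)
  qed (rule mult)
qed

text \<open>A \<open>line_section\<close> prescribes the multiplicity at every point of the line,
  also off the curve. At each point the form is restricted along a direction of the line with the
  parameter centred at that point, and a factorization exhibits the order at
  \<open>0\<close>.\<close>

lemma wsection_imp_line_section:
  assumes "wsection M"
  shows "\<exists>l. line_section F l (image_mset pt M)"
proof -
  have notin: "vec x y z \<notin> span {vec x' y' z'}"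
    if "x * z' \<noteq> z * x' \<or> x * y' \<noteq> y * x' \<or> y * z' \<noteq> z * y'" for x y z x' y' z'
    using that by (auto simp: span_singleton vec_scaleR vec_eq_iff)
  have nz: "vec x y z \<noteq> 0" if "x \<noteq> 0 \<or> y \<noteq> 0 \<or> z \<noteq> 0" for x y z
    using that by (auto simp: vec_0 vec_eq_iff)
  have on_line: "on_line (pt P) (line u v)"
    if "v \<noteq> 0" "u \<notin> span {v}" "coords P = s *\<^sub>R u + t *\<^sub>R v" for P u v s t
  proof -
    have "coords P \<in> Rep_proj_line (line u v)"
      using that by (auto simp: Rep_line span_pair)
    then show ?thesis
      unfolding on_line_def Rep_pt using Rep_proj_line[of "line u v"]
      by (intro span_minimal) auto
  qed
  have on_line_cases: "\<exists>s t x. x \<in> Rep_proj_point A \<and> x \<noteq> 0 \<and> x = s *\<^sub>R u + t *\<^sub>R v"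
    if "v \<noteq> 0" "u \<notin> span {v}" "on_line A (line u v)" for A u v
  proof -
    obtain x where x: "x \<in> Rep_proj_point A" "x \<noteq> 0" by (rule proj_point_nonzero)
    then have "x \<in> span {u, v}" using that by (auto simp: on_line_def Rep_line)
    then show ?thesis using x unfolding span_pair by blast
  qed
  consider "M = {#Inf, Inf, Inf#}" | x y where "y\<^sup>2 = poly f x" "M = {#Inf, Aff x y, Aff x (- y)#}"
    | l m x1 x2 x3 where "line_triple l m x1 x2 x3 M"
    using assms unfolding wsection_def by blast
  then show ?thesis
  proof cases
    case 1
    let ?u = "vec 1 0 0" and ?v = "vec 0 1 0"
    have uv: "?v \<noteq> 0" "?u \<notin> span {?v}" by (auto intro!: nz notin)
    have "line_section F (line ?u ?v) (image_mset pt M)"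
    proof (rule line_sectionI[OF uv])
      show "on_line A (line ?u ?v)" if "A \<in># image_mset pt M" for A
        using that 1 on_line[OF uv, of Inf 0 1] by (auto simp: vec_scaleR vec_add)
      fix A assume A: "on_line A (line ?u ?v)"
      obtain s t where st: "vec s t 0 \<in> Rep_proj_point A" "vec s t 0 \<noteq> 0"
        using on_line_cases[OF uv A] by (auto simp: vec_scaleR vec_add)
      show "count (image_mset pt M) A = intersection_mult F (line ?u ?v) A"
      proof (cases "s = 0")
        case True
        then have t: "t \<noteq> 0" using st by (auto simp: vec_0)
        have "intersection_mult F (line ?u ?v) A = Polynomial.order 0 (smult k [:0, 0, 0, 1:])"
        proof (rule intersection_mult_eqI[OF A st])
          show "?u \<in> Rep_proj_line (line ?u ?v)" using uv by (simp add: Rep_line span_base)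
          show "?u \<notin> span {vec s t 0}" using True t by (intro notin) auto
        qed (use True in \<open>simp add: vec_scaleR vec_add eval3_vec power3_eq_cube\<close>)
        also have "\<dots> = 3"
        proof -
          have "[:0, 0, 0, 1:] = [:- (0 :: real), 1:] ^ 3" by (simp add: power3_eq_cube)
          then show ?thesis using k order_power_n_n[of "0 :: real" 3] by (simp add: order_smult)
        qed
        finally show ?thesis using 1 pt_Inf_eqI[of t A] st True t by simp
      next
        case False
        have "intersection_mult F (line ?u ?v) A = Polynomial.order 0 [:k * s ^ 3:]"
        proof (rule intersection_mult_eqI[OF A st])
          show "?v \<in> Rep_proj_line (line ?u ?v)" using uv by (simp add: Rep_line span_base)
          show "?v \<notin> span {vec s t 0}" using False by (intro notin) auto
        qed (simp add: vec_scaleR vec_add eval3_vec)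
        also have "\<dots> = 0" using k False by (intro order_0I) simp
        moreover have "A \<noteq> pt Inf"
          using st False by (auto simp: Rep_pt span_singleton vec_scaleR vec_eq_iff)
        ultimately show ?thesis using 1 by simp
      qed
    qed
    then show ?thesis by blast
  next
    case (2 x y)
    let ?u = "vec 0 1 0" and ?v = "vec x 0 1"
    have uv: "?v \<noteq> 0" "?u \<notin> span {?v}" by (auto intro!: nz notin)
    have inl: "?u \<in> Rep_proj_line (line ?u ?v)" "?v \<in> Rep_proj_line (line ?u ?v)"
      using uv by (simp_all add: Rep_line span_base)
    have "line_section F (line ?u ?v) (image_mset pt M)"
    proof (rule line_sectionI[OF uv])
      show "on_line A (line ?u ?v)" if "A \<in># image_mset pt M" for A
        using that 2(2) on_line[OF uv, of Inf 1 0] on_line[OF uv, of "Aff x y" y 1]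
          on_line[OF uv, of "Aff x (- y)" "- y" 1]
        by (auto simp: vec_scaleR vec_add)
      fix A assume A: "on_line A (line ?u ?v)"
      obtain s t where st: "vec (t * x) s t \<in> Rep_proj_point A" "vec (t * x) s t \<noteq> 0"
        using on_line_cases[OF uv A] by (auto simp: vec_scaleR vec_add)
      show "count (image_mset pt M) A = intersection_mult F (line ?u ?v) A"
      proof (cases "t = 0")
        case True
        then have AI: "A = pt Inf" using st by (auto simp: vec_0 intro: pt_Inf_eqI)
        have "intersection_mult F (line ?u ?v) A =
          Polynomial.order 0 ([:0, 1:] * [:- k, 0, k * poly f x:])"
        proof (rule intersection_mult_eqI[OF A])
          show "coords Inf \<in> Rep_proj_point A" unfolding AI by (rule coords_in_pt)
          show "?v \<notin> span {coords Inf}" unfolding coords.simps by (intro notin) auto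
          show "coords Inf \<noteq> 0" by (rule coords_nz)
        qed (use inl in \<open>simp_all add: vec_scaleR vec_add eval3_vec f_def
          power2_eq_square power3_eq_cube algebra_simps\<close>)
        also have "\<dots> = Polynomial.order 0 [:0 :: real, 1:] + Polynomial.order 0 [:- k, 0, k * poly f x:]"
          using k by (intro order_mult) auto
        also have "Polynomial.order 0 [:- k, 0, k * poly f x:] = 0" using k by (intro order_0I) simp
        finally show ?thesis using 2(2) by (simp add: AI pt_inject order_0_linear)
      next
        case False
        define y' where "y' = s / t"
        have AI: "A = pt (Aff x y')" using pt_Aff_eqI[OF st(1) False] False by (simp add: y'_def)
        have "intersection_mult F (line ?u ?v) A =
          Polynomial.order 0 (smult (- k) ([:y' - y, 1:] * [:y' + y, 1:]))"
        proof (rule intersection_mult_eqI[OF A])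
          show "coords (Aff x y') \<in> Rep_proj_point A" unfolding AI by (rule coords_in_pt)
          show "?u \<notin> span {coords (Aff x y')}" unfolding coords.simps by (intro notin) auto
          fix \<tau>
          have "eval3 F (coords (Aff x y') + \<tau> *\<^sub>R ?u) = k * (poly f x - (y' + \<tau>)\<^sup>2)"
            by (simp add: vec_scaleR vec_add eval3_vec f_def
                power2_eq_square power3_eq_cube algebra_simps)
          also have "\<dots> = k * (y\<^sup>2 - (y' + \<tau>)\<^sup>2)" using 2(1) by simp
          finally show "eval3 F (coords (Aff x y') + \<tau> *\<^sub>R ?u) =
              poly (smult (- k) ([:y' - y, 1:] * [:y' + y, 1:])) \<tau>"
            by (simp add: power2_eq_square algebra_simps)
          show "coords (Aff x y') \<noteq> 0" by (rule coords_nz)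
        qed (use inl in simp_all)
        also have "\<dots> = Polynomial.order 0 [:y' - y, 1:] + Polynomial.order 0 [:y' + y, 1:]"
        proof -
          have nz: "[:y' - y, 1:] * [:y' + y, 1:] \<noteq> 0" by (simp only: mult_eq_0_iff pCons_eq_0_iff) simp
          have "- k \<noteq> 0" using k by simp
          show ?thesis unfolding order_smult[OF \<open>- k \<noteq> 0\<close>] order_mult[OF nz] ..
        qed
        also have "\<dots> = (if y' = y then 1 else 0) + (if y' = - y then 1 else 0)"
          by (simp only: order_0_linear eq_neg_iff_add_eq_0 right_minus_eq)
        finally show ?thesis using 2(2) by (auto simp: AI pt_inject)
      qed
    qed
    then show ?thesis by blast
  next
    case (3 l m x1 x2 x3)
    then have fact: "f - [:m, l:]\<^sup>2 = [:- x1, 1:] * [:- x2, 1:] * [:- x3, 1:]"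
      and M: "M = {#Aff x1 (l * x1 + m), Aff x2 (l * x2 + m), Aff x3 (l * x3 + m)#}"
      by (auto simp: line_triple_def)
    let ?u = "vec 1 l 0" and ?v = "vec 0 m 1"
    have uv: "?v \<noteq> 0" "?u \<notin> span {?v}" by (auto intro!: nz notin)
    have inl: "?u \<in> Rep_proj_line (line ?u ?v)" "?v \<in> Rep_proj_line (line ?u ?v)"
      using uv by (simp_all add: Rep_line span_base)
    have "line_section F (line ?u ?v) (image_mset pt M)"
    proof (rule line_sectionI[OF uv])
      have "on_line (pt (Aff x (l * x + m))) (line ?u ?v)" for x
        using on_line[OF uv, of "Aff x (l * x + m)" x 1]
        by (simp add: vec_scaleR vec_add mult.commute)
      then show "on_line A (line ?u ?v)" if "A \<in># image_mset pt M" for A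
        using that M by auto
      fix A assume A: "on_line A (line ?u ?v)"
      obtain s t where st: "vec s (s * l + t * m) t \<in> Rep_proj_point A" "vec s (s * l + t * m) t \<noteq> 0"
        using on_line_cases[OF uv A] by (auto simp: vec_scaleR vec_add)
      show "count (image_mset pt M) A = intersection_mult F (line ?u ?v) A"
      proof (cases "t = 0")
        case True
        then have s: "s \<noteq> 0" using st by (auto simp: vec_0)
        \<comment> \<open>The point at infinity of this line is off the curve: the constant
          coefficient is nonzero.\<close>
        have "intersection_mult F (line ?u ?v) A = Polynomial.order 0
          [:k * s ^ 3, k * (a2 * s\<^sup>2 - (s * l)\<^sup>2), k * (a4 * s - 2 * s * l * m), k * (a6 - m\<^sup>2):]"
        proof (rule intersection_mult_eqI[OF A st inl(2)])
          show "?v \<notin> span {vec s (s * l + t * m) t}" using True s by (intro notin) auto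
        qed (use True in \<open>simp add: vec_scaleR vec_add eval3_vec power2_eq_square power3_eq_cube
          algebra_simps\<close>)
        also have "\<dots> = 0" using k s by (intro order_0I) simp
        moreover have "pt (Aff x y) \<noteq> A" for x y
        proof
          assume "pt (Aff x y) = A"
          then show False using st True s by (auto simp: Rep_pt span_singleton vec_scaleR vec_eq_iff)
        qed
        ultimately show ?thesis using M by simp
      next
        case False
        define x where "x = s / t"
        have "A = pt (Aff (s / t) ((s * l + t * m) / t))" by (rule pt_Aff_eqI[OF st(1) False])
        also have "(s * l + t * m) / t = l * x + m" using False by (simp add: x_def field_simps)
        finally have AI: "A = pt (Aff x (l * x + m))" by (simp add: x_def)
        \<comment> \<open>Each linear factor vanishes at \<open>0\<close> exactly when
          \<open>x\<close> is the corresponding abscissa, so the orders add up to the count in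
          \<open>M\<close>.\<close>
        have "intersection_mult F (line ?u ?v) A =
          Polynomial.order 0 (smult k ([:x - x1, 1:] * [:x - x2, 1:] * [:x - x3, 1:]))"
        proof (rule intersection_mult_eqI[OF A])
          show "coords (Aff x (l * x + m)) \<in> Rep_proj_point A" unfolding AI by (rule coords_in_pt)
          show "?u \<notin> span {coords (Aff x (l * x + m))}" unfolding coords.simps by (intro notin) auto
          fix \<tau>
          have "eval3 F (coords (Aff x (l * x + m)) + \<tau> *\<^sub>R ?u) = k * poly (f - [:m, l:]\<^sup>2) (x + \<tau>)"
            by (simp add: vec_scaleR vec_add eval3_vec f_def
                power2_eq_square power3_eq_cube algebra_simps)
          also have "\<dots> = poly (smult k ([:x - x1, 1:] * [:x - x2, 1:] * [:x - x3, 1:])) \<tau>"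
            unfolding fact poly_smult poly_mult by (simp add: algebra_simps)
          finally show "eval3 F (coords (Aff x (l * x + m)) + \<tau> *\<^sub>R ?u) =
              poly (smult k ([:x - x1, 1:] * [:x - x2, 1:] * [:x - x3, 1:])) \<tau>" .
          show "coords (Aff x (l * x + m)) \<noteq> 0" by (rule coords_nz)
        qed (use inl in simp_all)
        also have "\<dots> = Polynomial.order 0 ([:x - x1, 1:] * [:x - x2, 1:] * [:x - x3, 1:])"
          using k by (rule order_smult)
        also have "\<dots> = Polynomial.order 0 ([:x - x1, 1:] * [:x - x2, 1:]) + Polynomial.order 0 [:x - x3, 1:]"
          by (rule order_mult) (simp only: mult_eq_0_iff pCons_eq_0_iff, simp)
        also have "Polynomial.order 0 ([:x - x1, 1:] * [:x - x2, 1:]) =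
            Polynomial.order 0 [:x - x1, 1:] + Polynomial.order 0 [:x - x2, 1:]"
          by (rule order_mult) (simp only: mult_eq_0_iff pCons_eq_0_iff, simp)
        finally show ?thesis using M by (auto simp: AI pt_inject order_0_linear)
      qed
    qed
    then show ?thesis by blast
  qed
qed

lemma third_point_pt:
  assumes "nonsing P" "wsection {#P, Q, R#}"
  shows "third_point F (pt P) (pt Q) = pt R"
proof -
  obtain l where "line_section F l {#pt P, pt Q, pt R#}"
    using wsection_imp_line_section[OF assms(2)] by auto
  then show ?thesis
    using third_point_eqI[OF hom] pt_nonsingular_iff assms(1) by blast
qed

lemma collinear_third_point:
  assumes on: "on_line A l" "on_line B l" "on_line C l"
    and dist: "A \<noteq> B" "A \<noteq> C" "B \<noteq> C"
    and curve: "A \<in> curve_points F" "B \<in> curve_points F" "C \<in> curve_points F"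
  shows "A \<in> nonsingular_points F" "B \<in> nonsingular_points F" "third_point F A B = C"
proof -
  obtain P Q R where PQR: "A = pt P" "B = pt Q" "C = pt R"
    "on_wcurve P" "on_wcurve Q" "on_wcurve R"
    using curve_point_cases curve by metis
  \<comment> \<open>A normal vector of the plane turns the line into a linear equation with
    coefficients \<open>n \<bullet> p\<close>, \<open>n \<bullet> q\<close>,
    \<open>n \<bullet> r\<close> in the basis.\<close>
  obtain n where n: "n \<noteq> 0" "\<And>v. v \<in> Rep_proj_line l \<Longrightarrow> n \<bullet> v = 0"
  proof -
    have "dim (Rep_proj_line l) < DIM(real ^ 3)" using Rep_proj_line[of l] by simp
    then obtain n where "n \<noteq> 0" "\<And>y. y \<in> span (Rep_proj_line l) \<Longrightarrow> orthogonal n y"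
      using orthogonal_to_subspace_exists[of "Rep_proj_line l"] by metis
    then show ?thesis using that by (simp add: orthogonal_def span_base)
  qed
  have wl: "on_wline (n \<bullet> p) (n \<bullet> q) (n \<bullet> r) S" if "on_line (pt S) l" for S
  proof -
    have "n \<bullet> coords S = 0" using that coords_in_pt n(2) by (auto simp: on_line_def)
    then show ?thesis by (cases S) (auto simp: vec_def inner_add_right mult.commute)
  qed
  have "n \<bullet> p \<noteq> 0 \<or> n \<bullet> q \<noteq> 0 \<or> n \<bullet> r \<noteq> 0"
  proof (rule ccontr)
    assume *: "\<not> ?thesis"
    obtain x y z where xyz: "n = x *\<^sub>R p + y *\<^sub>R q + z *\<^sub>R r" using basis by blast
    have "n \<bullet> n = x * (n \<bullet> p) + y * (n \<bullet> q) + z * (n \<bullet> r)"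
      by (subst (2) xyz) (simp add: inner_add_right)
    then show False using * n(1) by simp
  qed
  then have ns: "nonsing P \<and> nonsing Q \<and> nonsing R \<and> wsection {#P, Q, R#}"
    using collinear_imp_wsection wl on dist PQR by blast
  then show "A \<in> nonsingular_points F" "B \<in> nonsingular_points F" "third_point F A B = C"
    using PQR pt_nonsingular_iff third_point_pt by auto
qed

section \<open>The chord-tangent operation and its associativity\<close>

definition third :: "wpoint \<Rightarrow> wpoint \<Rightarrow> wpoint" where
  "third P Q = (SOME R. nonsing R \<and> wsection {#P, Q, R#})"

lemma third:
  assumes "nonsing P" "nonsing Q"
  shows "nonsing (third P Q)" "wsection {#P, Q, third P Q#}"
  unfolding third_def using someI_ex[OF wsection_third_exists[OF assms]] by auto

text \<open>Uniqueness comes from the ideal classes, with \<open>{#P, Q#}\<close> as the common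
  part; this makes the arbitrary choice in \<open>third\<close> harmless.\<close>

lemma third_eqI:
  assumes "nonsing P" "nonsing Q" "nonsing R" "wsection {#P, Q, R#}"
  shows "third P Q = R"
proof (rule principal_unique[of _ "{#P, Q#}"])
  show "principal (add_mset (third P Q) {#P, Q#})" "principal (add_mset R {#P, Q#})"
    using third[OF assms(1,2)] assms principal_wsection[of "{#P, Q, R#}"]
      principal_wsection[of "{#P, Q, third P Q#}"]
    by (simp_all add: add_mset_commute insert_commute) (auto simp: add_mset_commute)
qed (use assms third in auto)

lemma third_commute: "third P Q = third Q P"
  by (simp add: third_def add_mset_commute)

lemma third_third:
  assumes "nonsing P" "nonsing Q"
  shows "third P (third P Q) = Q"
  using third[OF assms] assms by (intro third_eqI) (auto simp: add_mset_commute)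

lemma third_Inf_Inf: "third Inf Inf = Inf"
  by (rule third_eqI) (auto simp: wsection_def)

text \<open>The configuration of Cayley and Bacharach: two triples of lines share the eight points
  of \<open>?M\<close>, so both ninth points complete \<open>?M\<close> to a principal multiset and
  must agree.\<close>

lemma third_assoc:
  assumes ns: "nonsing P" "nonsing Q" "nonsing R"
  shows "third (third Inf (third P Q)) R = third P (third Inf (third Q R))"
proof -
  let ?X = "third P Q" and ?Z = "third Q R"
  let ?S = "third Inf ?X" and ?T = "third Inf ?Z"
  have [simp]: "nonsing ?X" "nonsing ?Z" "nonsing ?S" "nonsing ?T"
    "nonsing (third ?S R)" "nonsing (third P ?T)"
    using ns by (auto intro!: third)
  have principal: "principal {#A, B, third A B#}" if "nonsing A" "nonsing B" for A B
    using principal_wsection[OF third(2)[OF that]] third(1)[OF that] that by auto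
  let ?M = "{#P, Q, ?X, Inf, ?Z, ?T, ?S, R#}"
  show ?thesis
  proof (rule principal_unique[of _ ?M])
    have "principal ({#P, Q, ?X#} + ({#Inf, ?Z, ?T#} + {#?S, R, third ?S R#}))"
      using ns by (intro principal_add principal) simp_all
    moreover have "{#P, Q, ?X#} + ({#Inf, ?Z, ?T#} + {#?S, R, third ?S R#}) = add_mset (third ?S R) ?M"
      by simp
    ultimately show "principal (add_mset (third ?S R) ?M)" by (simp only:)
    have "principal ({#Q, R, ?Z#} + ({#Inf, ?X, ?S#} + {#P, ?T, third P ?T#}))"
      using ns by (intro principal_add principal) simp_all
    moreover have "{#Q, R, ?Z#} + ({#Inf, ?X, ?S#} + {#P, ?T, third P ?T#}) = add_mset (third P ?T) ?M"
      by simp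
    ultimately show "principal (add_mset (third P ?T) ?M)" by (simp only:)
  qed (use ns in auto)
qed

lemma third_point_third:
  "nonsing P \<Longrightarrow> nonsing Q \<Longrightarrow> third_point F (pt P) (pt Q) = pt (third P Q)"
  using third_point_pt third by blast

lemma nonsingular_cases:
  assumes "A \<in> nonsingular_points F"
  obtains P where "nonsing P" "A = pt P"
proof -
  have "A \<in> curve_points F" using assms by (simp add: nonsingular_points_def)
  then show ?thesis using curve_point_cases pt_nonsingular_iff assms that by metis
qed

lemma comm_group_cubic_group: "comm_group (cubic_group F e)"
proof (rule comm_groupI)
  let ?G = "cubic_group F e"
  have carrier: "carrier ?G = nonsingular_points F" and one: "\<one>\<^bsub>?G\<^esub> = pt Inf"
    by (simp_all add: cubic_group_def pt_Inf)
  have mult: "pt P \<otimes>\<^bsub>?G\<^esub> pt Q = pt (third Inf (third P Q))" if "nonsing P" "nonsing Q" for P Q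
    using that third by (simp add: cubic_group_def third_point_third flip: pt_Inf)
  have closed: "nonsing (third Inf (third P Q))" if "nonsing P" "nonsing Q" for P Q
    using that third by simp
  note simps = mult one closed third third_third third_Inf_Inf pt_nonsingular_iff carrier
  show "\<one>\<^bsub>?G\<^esub> \<in> carrier ?G" by (simp add: simps)
  fix A assume "A \<in> carrier ?G"
  then obtain P where P: "nonsing P" "A = pt P" unfolding carrier by (rule nonsingular_cases)
  show "\<one>\<^bsub>?G\<^esub> \<otimes>\<^bsub>?G\<^esub> A = A" using P by (simp add: simps)
  have "third (third Inf P) P = Inf"
    using P third_third[of P Inf] by (simp add: third_commute)
  then have "pt (third Inf P) \<otimes>\<^bsub>?G\<^esub> A = \<one>\<^bsub>?G\<^esub>" using P by (simp add: simps)
  then show "\<exists>B\<in>carrier ?G. B \<otimes>\<^bsub>?G\<^esub> A = \<one>\<^bsub>?G\<^esub>"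
    using P by (intro bexI[of _ "pt (third Inf P)"]) (simp_all add: simps)
  fix B assume "B \<in> carrier ?G"
  then obtain Q where Q: "nonsing Q" "B = pt Q" unfolding carrier by (rule nonsingular_cases)
  show "A \<otimes>\<^bsub>?G\<^esub> B \<in> carrier ?G" using P Q by (simp add: simps)
  show "A \<otimes>\<^bsub>?G\<^esub> B = B \<otimes>\<^bsub>?G\<^esub> A" using P Q by (simp add: mult third_commute)
  fix C assume "C \<in> carrier ?G"
  then obtain R where R: "nonsing R" "C = pt R" unfolding carrier by (rule nonsingular_cases)
  show "A \<otimes>\<^bsub>?G\<^esub> B \<otimes>\<^bsub>?G\<^esub> C = A \<otimes>\<^bsub>?G\<^esub> (B \<otimes>\<^bsub>?G\<^esub> C)"
    using P Q R by (simp add: mult closed third_assoc)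
qed

end

section \<open>Reduction to Weierstrass coordinates\<close>

text \<open>Every constant \<open>[:y:]\<close> is a root of \<open>h\<close> over
  \<open>\<real>[x]\<close>, and only the zero polynomial has infinitely many roots.\<close>

lemma poly_poly_eq_0I:
  fixes h :: "real poly poly"
  assumes "\<And>x y. poly (poly h [:y:]) x = 0"
  shows "h = 0"
proof (rule ccontr)
  assume "h \<noteq> 0"
  have "poly h [:y:] = 0" for y
    using assms by (intro poly_eq_poly_eq_iff[THEN iffD1]) auto
  then have "range (\<lambda>y. [:y:]) \<subseteq> {g. poly h g = 0}" by auto
  then have "finite (range (\<lambda>y :: real. [:y:]))"
    using poly_roots_finite[OF \<open>h \<noteq> 0\<close>] finite_subset by blast
  then show False
    using finite_imageD[of "\<lambda>y :: real. [:y:]" UNIV] infinite_UNIV_char_0 by (auto simp: inj_def)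
qed

text \<open>The cofactor of a nonunit divisor \<open>U\<close> is a unit, hence a real constant, so
  \<open>U\<close> would itself be homogeneous of degree three.\<close>

lemma irreducible_cubic_no_linear_factor:
  assumes F: "irreducible_cubic F" and U: "U dvd F" "\<not> U dvd 1" "coeff3 U i j k \<noteq> 0" "i + j + k \<noteq> 3"
  shows False
proof -
  obtain Q where Q: "F = U * Q" using U(1) by (auto elim: dvdE)
  then have "Q dvd 1" using F U(2) irreducibleD unfolding irreducible_cubic_def by blast
  then obtain c where c: "Q = [:[:[:c:]:]:]" "c dvd 1"
    by (auto simp: is_unit_poly_iff)
  then have "c \<noteq> 0" by auto
  have "coeff3 F i j k = c * coeff3 U i j k"
    unfolding Q c(1) coeff3_def by (simp add: mult.commute)
  then have "coeff3 F i j k \<noteq> 0" using U \<open>c \<noteq> 0\<close> by simp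
  then show False using F U(4) unfolding irreducible_cubic_def homogeneous3_def by blast
qed

text \<open>Solving the equation of the line for one variable and substituting gives the zero
  polynomial, so \<open>F\<close> has a linear factor. The cases follow the outermost variable that
  occurs, because substitution takes a different form at each level of
  \<open>\<real>[X][Y][Z]\<close>.\<close>

lemma irreducible_cubic_nonzero_on_line:
  assumes F: "irreducible_cubic F" and n: "n \<noteq> 0" and vanish: "\<And>v. n \<bullet> v = 0 \<Longrightarrow> eval3 F v = 0"
  shows False
proof -
  have inner: "n \<bullet> vector [x, y, z] = n $ 1 * x + n $ 2 * y + n $ 3 * z" for x y z
    by (simp add: inner_vec_def sum_3)
  obtain a b c d e g h i j k where
    expl: "F = [:[:[:0, 0, 0, a:], [:0, 0, b:], [:0, c:], [:d:]:], [:[:0, 0, e:], [:0, g:], [:h:]:],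
      [:[:0, i:], [:j:]:], [:[:k:]:]:]"
    using cubic_form_explicit F unfolding irreducible_cubic_def by blast
  have eval: "eval3 F (vector [x, y, z]) = a * x ^ 3 + b * x\<^sup>2 * y + c * x * y\<^sup>2 + d * y ^ 3
      + z * (e * x\<^sup>2 + g * x * y + h * y\<^sup>2) + z\<^sup>2 * (i * x + j * y) + k * z ^ 3" for x y z
    unfolding expl eval3_def by (simp add: power2_eq_square power3_eq_cube algebra_simps)
  consider "n $ 3 \<noteq> 0" | "n $ 3 = 0" "n $ 2 \<noteq> 0" | "n $ 3 = 0" "n $ 2 = 0" "n $ 1 \<noteq> 0"
    using n by (auto simp: vec_eq_iff forall_3)
  then show False
  proof cases
    case 1
    define s t where "s = - n $ 1 / n $ 3" and "t = - n $ 2 / n $ 3"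
    let ?g = "[:[:0, s:], [:t:]:]"
    have "poly F ?g = 0"
    proof (rule poly_poly_eq_0I)
      fix x y
      have "n \<bullet> vector [x, y, s * x + t * y] = 0"
        using 1 by (simp add: inner s_def t_def field_simps)
      from vanish[OF this] show "poly (poly (poly F ?g) [:y:]) x = 0"
        unfolding eval by (simp add: expl power2_eq_square power3_eq_cube algebra_simps)
    qed
    then have "[:- ?g, 1:] dvd F" by (simp add: poly_eq_0_iff_dvd)
    moreover have "\<not> [:- ?g, 1:] dvd 1" by (auto simp: is_unit_poly_iff)
    moreover have "coeff3 [:- ?g, 1:] 0 0 1 \<noteq> 0" by (simp add: coeff3_def)
    ultimately show False by (rule irreducible_cubic_no_linear_factor[OF F]) simp
  next
    case 2
    define s where "s = - n $ 1 / n $ 2"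
    let ?g = "[:0, s:]"
    have "map_poly (\<lambda>q. poly q ?g) F = 0"
    proof (rule poly_poly_eq_0I)
      fix x z
      have "n \<bullet> vector [x, s * x, z] = 0"
        using 2 by (simp add: inner s_def field_simps)
      from vanish[OF this] show "poly (poly (map_poly (\<lambda>q. poly q ?g) F) [:z:]) x = 0"
        unfolding eval
        by (simp add: expl map_poly_pCons power2_eq_square power3_eq_cube algebra_simps)
    qed
    then have "poly (coeff F m) ?g = 0" for m
      by (metis coeff_0 coeff_map_poly poly_0)
    then have "[:[:- ?g, 1:]:] dvd F" by (simp only: const_poly_dvd_iff poly_eq_0_iff_dvd simp_thms)
    moreover have "\<not> [:[:- ?g, 1:]:] dvd 1" by (auto simp: is_unit_poly_iff)
    moreover have "coeff3 [:[:- ?g, 1:]:] 0 1 0 \<noteq> 0" by (simp add: coeff3_def)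
    ultimately show False by (rule irreducible_cubic_no_linear_factor[OF F]) simp
  next
    case 3
    have "map_poly (map_poly (\<lambda>q. poly q 0)) F = 0"
    proof (rule poly_poly_eq_0I)
      fix y z
      have "n \<bullet> vector [0, y, z] = 0"
        using 3 by (simp add: inner)
      from vanish[OF this] show "poly (poly (map_poly (map_poly (\<lambda>q. poly q 0)) F) [:z:]) y = 0"
        unfolding eval
        by (simp add: expl map_poly_pCons power2_eq_square power3_eq_cube algebra_simps)
    qed
    then have "map_poly (\<lambda>q. poly q 0) (coeff F m) = 0" for m
      by (metis coeff_0 coeff_map_poly map_poly_0)
    then have "poly (coeff (coeff F m) m') 0 = 0" for m m'
      by (metis coeff_0 coeff_map_poly poly_0)
    then have "[:[:[:- 0, 1:]:]:] dvd F" by (simp only: const_poly_dvd_iff poly_eq_0_iff_dvd simp_thms)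
    moreover have "\<not> [:[:[:- 0, 1 :: real:]:]:] dvd 1" by (auto simp: is_unit_poly_iff)
    moreover have "coeff3 [:[:[:- 0, 1:]:]:] 1 0 0 \<noteq> 0" by (simp add: coeff3_def)
    ultimately show False by (rule irreducible_cubic_no_linear_factor[OF F]) simp
  qed
qed

text \<open>The inflectional tangent becomes \<open>z = 0\<close>. There the form reduces to a
  multiple of \<open>x\<^sup>3\<close>, nonzero by irreducibility; the coefficient of
  \<open>y\<^sup>2 z\<close> is a derivative at \<open>e\<close>, nonzero because \<open>e\<close>
  is nonsingular.\<close>

lemma exists_weierstrass_cubic:
  assumes F: "irreducible_cubic F" and e: "inflection_point F e"
  shows "\<exists>a2 a4 a6 p q r k. weierstrass_cubic a2 a4 a6 F e p q r k"
proof -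
  have hom: "homogeneous3 3 F" using F by (simp add: irreducible_cubic_def)
  obtain l where l: "intersection_mult F l e \<ge> 3" and ens: "e \<in> nonsingular_points F"
    using e by (auto simp: inflection_point_def)
  have on: "on_line e l" using l by (auto simp: intersection_mult_def split: if_splits)
  obtain q where q: "q \<in> Rep_proj_point e" "q \<noteq> 0" by (rule proj_point_nonzero)
  obtain w where w: "w \<in> Rep_proj_line l" "w \<notin> Rep_proj_point e" by (rule proj_line_off_point)
  have Re: "Rep_proj_point e = span {q}" by (rule Rep_proj_point_eq_span[OF q])
  have "q \<in> Rep_proj_line l" using on q by (auto simp: on_line_def)
  then have Rl: "Rep_proj_line l = span {w, q}"
    using Rep_proj_line_eq_span q w Re by simp
  have sl: "subspace (Rep_proj_line l)" "dim (Rep_proj_line l) = 2" using Rep_proj_line by auto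
  have "coeff (restrict_line F q w) i = 0" if "i < 3" for i
    using l intersection_mult_eq_order[OF hom on q w] that by (intro coeff_below_order_0) simp
  from this[of 0] this[of 1] this[of 2]
  have van: "eval3 F q = 0" "dir_deriv F q w = 0" "dir_deriv F w q = 0"
    by (simp_all add: restrict_line_expand[OF hom] numeral_2_eq_2)
  \<comment> \<open>Otherwise all four coefficients on the tangent vanish and the whole line lies on
    the curve.\<close>
  have A: "eval3 F w \<noteq> 0"
  proof
    assume 0: "eval3 F w = 0"
    have "dim (Rep_proj_line l) < DIM(real ^ 3)" using sl by simp
    then obtain n where n: "n \<noteq> 0" "\<And>y. y \<in> span (Rep_proj_line l) \<Longrightarrow> orthogonal n y"
      using orthogonal_to_subspace_exists[of "Rep_proj_line l"] by metis
    have "Rep_proj_line l = {v. n \<bullet> v = 0}"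
    proof (rule subspace_dim_equal[OF sl(1) subspace_hyperplane])
      show "Rep_proj_line l \<subseteq> {v. n \<bullet> v = 0}" using n(2) by (auto simp: orthogonal_def span_base)
      show "dim {v. n \<bullet> v = 0} \<le> dim (Rep_proj_line l)"
        using dim_hyperplane[OF n(1)] sl by simp
    qed
    then have "eval3 F v = 0" if "n \<bullet> v = 0" for v
    proof -
      have "v \<in> span {w, q}" using that \<open>Rep_proj_line l = {v. n \<bullet> v = 0}\<close> Rl by blast
      then show ?thesis using van 0 by (auto simp: span_pair eval3_combination[OF hom])
    qed
    then show False using irreducible_cubic_nonzero_on_line[OF F n(1)] by blast
  qed
  obtain u where u: "u \<notin> Rep_proj_line l"
  proof -
    have "Rep_proj_line l \<noteq> UNIV" using sl(2) by auto
    then show ?thesis using that by blast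
  qed
  have "dim {u, w, q} = 3" using u w q Re Rl by (simp add: dim_insert)
  then have "span {u, w, q} = UNIV" using dim_eq_full[of "{u, w, q}"] by simp
  then have spans: "\<exists>x y z. v = x *\<^sub>R w + y *\<^sub>R q + z *\<^sub>R u" for v
  proof -
    have "v \<in> span (insert u {w, q})" using \<open>span {u, w, q} = UNIV\<close> by simp
    then obtain z where "v - z *\<^sub>R u \<in> span {w, q}" unfolding span_insert by blast
    then obtain x y where "v - z *\<^sub>R u = x *\<^sub>R w + y *\<^sub>R q" unfolding span_pair by blast
    then have "v = x *\<^sub>R w + y *\<^sub>R q + z *\<^sub>R u" by (simp add: algebra_simps)
    then show ?thesis by blast
  qed
  have ind: "x = 0 \<and> y = 0 \<and> z = 0" if eq: "x *\<^sub>R w + y *\<^sub>R q + z *\<^sub>R u = 0" for x y z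
  proof -
    have "z = 0"
    proof (rule ccontr)
      assume "z \<noteq> 0"
      have "z *\<^sub>R u = (- x) *\<^sub>R w + (- y) *\<^sub>R q"
        using eq by (simp add: eq_neg_iff_add_eq_0 algebra_simps)
      then have "z *\<^sub>R u \<in> Rep_proj_line l" unfolding Rl span_pair by blast
      then have "(1 / z) *\<^sub>R (z *\<^sub>R u) \<in> Rep_proj_line l" by (rule subspace_scale[OF sl(1)])
      then show False using \<open>z \<noteq> 0\<close> u by simp
    qed
    moreover have "x = 0"
    proof (rule ccontr)
      assume "x \<noteq> 0"
      have "x *\<^sub>R w = (- y) *\<^sub>R q"
        using eq \<open>z = 0\<close> by (simp add: eq_neg_iff_add_eq_0)
      then have "(1 / x) *\<^sub>R (x *\<^sub>R w) = (- y / x) *\<^sub>R q" by simp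
      then have "w = (- y / x) *\<^sub>R q" using \<open>x \<noteq> 0\<close> by simp
      then show False using w Re by (metis rangeI span_singleton)
    qed
    ultimately show ?thesis using eq q by simp
  qed
  obtain g where g: "\<And>x y z. eval3 F (x *\<^sub>R w + y *\<^sub>R q + z *\<^sub>R u) =
      eval3 F w * x ^ 3 + dir_deriv F w q * x\<^sup>2 * y + dir_deriv F q w * x * y\<^sup>2 + eval3 F q * y ^ 3 +
      z * (dir_deriv F w u * x\<^sup>2 + g * x * y + dir_deriv F q u * y\<^sup>2
        + dir_deriv F u w * x * z + dir_deriv F u q * y * z + eval3 F u * z\<^sup>2)"
    using cubic_in_basis[OF hom, of w q u] by blast
  define B where "B = dir_deriv F q u"
  \<comment> \<open>The derivative at \<open>e\<close> vanishes along \<open>w\<close> and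
    \<open>q\<close>, so at a nonsingular point it cannot vanish along \<open>u\<close>.\<close>
  have B: "B \<noteq> 0"
  proof
    assume "B = 0"
    obtain d where d: "dir_deriv F q d \<noteq> 0" using nonsingular_points_iff[OF hom q] ens by blast
    obtain x y z where "d = x *\<^sub>R w + y *\<^sub>R q + z *\<^sub>R u" using spans by blast
    then show False
      using d van \<open>B = 0\<close>
      by (simp add: B_def dir_deriv_add dir_deriv_scaleR dir_deriv_self[OF hom])
  qed
  \<comment> \<open>Division by \<open>B\<close> makes the coefficient of \<open>y\<^sup>2 z\<close>
    equal to one; the halves prepare for completing the square.\<close>
  define s h j c2 c4 c6 where coeffs: "s = eval3 F w / B" "h = g / (2 * B)" "j = dir_deriv F u q / (2 * B)"
    "c2 = dir_deriv F w u / B" "c4 = dir_deriv F u w / B" "c6 = eval3 F u / B"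
  have s: "s \<noteq> 0" using A B by (simp add: coeffs)
  have G: "eval3 F (x *\<^sub>R w + y *\<^sub>R q + z *\<^sub>R u) = B * (s * x ^ 3 +
      z * (c2 * x\<^sup>2 + 2 * h * x * y + y\<^sup>2 + c4 * x * z + 2 * j * y * z + c6 * z\<^sup>2))" for x y z
    unfolding g van B_def[symmetric] using B by (simp add: coeffs algebra_simps)
  text \<open>Completing the square in \<open>y\<close> and rescaling \<open>z\<close>.\<close>
  define p r where "p = w - h *\<^sub>R q" and "r = (- s) *\<^sub>R (u - j *\<^sub>R q)"
  have comb: "x *\<^sub>R p + y *\<^sub>R q + z *\<^sub>R r = x *\<^sub>R w + (y - h * x + j * s * z) *\<^sub>R q + (- s * z) *\<^sub>R u"
    for x y z
    by (simp add: p_def r_def algebra_simps)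
  have "weierstrass_cubic (h\<^sup>2 - c2) (s * (c4 - 2 * h * j)) (s\<^sup>2 * (j\<^sup>2 - c6)) F e p q r (B * s)"
  proof
    show "homogeneous3 3 F" by (rule hom)
    show "B * s \<noteq> 0" using B s by simp
    show "Rep_proj_point e = span {q}" by (rule Re)
    show "eval3 F (x *\<^sub>R p + y *\<^sub>R q + z *\<^sub>R r) = B * s * (x ^ 3 + (h\<^sup>2 - c2) * x\<^sup>2 * z +
        s * (c4 - 2 * h * j) * x * z\<^sup>2 + s\<^sup>2 * (j\<^sup>2 - c6) * z ^ 3 - y\<^sup>2 * z)" for x y z
      unfolding comb G by (simp add: power2_eq_square power3_eq_cube algebra_simps)
    show "x = 0 \<and> y = 0 \<and> z = 0" if "x *\<^sub>R p + y *\<^sub>R q + z *\<^sub>R r = 0" for x y z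
      using ind[OF that[unfolded comb]] s by auto
    show "\<exists>x y z. v = x *\<^sub>R p + y *\<^sub>R q + z *\<^sub>R r" for v
    proof -
      obtain x y z where v: "v = x *\<^sub>R w + y *\<^sub>R q + z *\<^sub>R u" using spans by blast
      have "v = x *\<^sub>R p + (y + h * x + j * z) *\<^sub>R q + (- z / s) *\<^sub>R r"
        unfolding comb v using s by simp
      then show ?thesis by blast
    qed
  qed
  then show ?thesis by blast
qed

lemma proj_line_through: "\<exists>l. on_line P l \<and> on_line Q l"
proof -
  obtain v where v: "v \<in> Rep_proj_point P" "v \<noteq> 0" by (rule proj_point_nonzero)
  obtain w where w: "w \<notin> span {v}" "Rep_proj_point Q \<subseteq> span {w, v}"
  proof (cases "Q = P")
    case True
    have "span {v} \<noteq> UNIV"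
    proof
      assume eq: "span {v} = UNIV"
      have "dim (span {v}) = 3" unfolding eq by simp
      then show False using v(2) by (simp add: dim_insert)
    qed
    then show ?thesis using that Rep_proj_point_eq_span[OF v] True span_mono[of "{v}"] by blast
  next
    case False
    obtain w where w: "w \<in> Rep_proj_point Q" "w \<noteq> 0" by (rule proj_point_nonzero)
    have "w \<notin> span {v}"
    proof
      assume "w \<in> span {v}"
      then have "w \<in> Rep_proj_point P" using Rep_proj_point_eq_span[OF v] by simp
      then have "Rep_proj_point P = Rep_proj_point Q" using Rep_proj_point_eq_span w by blast
      then show False using False by (simp add: Rep_proj_point_inject)
    qed
    moreover have "Rep_proj_point Q \<subseteq> span {w, v}"
      unfolding Rep_proj_point_eq_span[OF w] by (intro span_mono) auto
    ultimately show ?thesis by (rule that)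
  qed
  have "Rep_proj_line (Abs_proj_line (span {w, v})) = span {w, v}"
    using v w by (intro Abs_proj_line_inverse) (simp add: dim_insert)
  moreover have "Rep_proj_point P \<subseteq> span {w, v}"
    unfolding Rep_proj_point_eq_span[OF v] by (intro span_mono) auto
  ultimately show ?thesis using w(2) unfolding on_line_def by metis
qed

section \<open>Small product sets\<close>

context comm_group
begin

text \<open>The translates of \<open>B\<close> by \<open>a\<close> and \<open>a'\<close> both lie in
  \<open>A <#> B\<close>, so they share more than half of \<open>card B\<close> elements. A common
  element \<open>a \<otimes> b = a' \<otimes> b'\<close> says that \<open>a \<otimes> inv a'\<close>
  carries \<open>b\<close> to \<open>b'\<close>.\<close>

lemma card_diff_translate:
  assumes fin: "finite A" "finite B" and sub: "A \<subseteq> carrier G" "B \<subseteq> carrier G"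
    and a: "a \<in> A" "a' \<in> A" and card: "2 * card (A <#> B) < 3 * card B"
  shows "card B < 2 * card {b \<in> B. (a \<otimes> inv a') \<otimes> b \<in> B}"
proof -
  let ?X = "(\<lambda>b. a \<otimes> b) ` B" and ?Y = "(\<lambda>b. a' \<otimes> b) ` B"
    and ?C = "{b \<in> B. (a \<otimes> inv a') \<otimes> b \<in> B}"
  have "finite (A <#> B)" using fin by (simp add: set_mult_def)
  moreover have "?X \<union> ?Y \<subseteq> A <#> B" using a by (auto simp: set_mult_def)
  ultimately have union: "card (?X \<union> ?Y) \<le> card (A <#> B)" by (rule card_mono)
  have XY: "card ?X = card B" "card ?Y = card B"
    using a sub by (auto intro!: card_image inj_on_subset[OF inj_on_cmult])
  have sum: "card (?X \<union> ?Y) + card (?X \<inter> ?Y) = card ?X + card ?Y"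
    using fin by (intro card_Un_Int[symmetric]) auto
  have "card (?X \<inter> ?Y) \<le> card ?C"
  proof -
    have "?X \<inter> ?Y \<subseteq> (\<lambda>b. a \<otimes> b) ` ?C"
    proof
      fix z assume "z \<in> ?X \<inter> ?Y"
      then obtain b b' where b: "b \<in> B" "z = a \<otimes> b" "b' \<in> B" "z = a' \<otimes> b'" by auto
      have [simp]: "a \<in> carrier G" "a' \<in> carrier G" "b \<in> carrier G" "b' \<in> carrier G"
        using a b sub by auto
      have "(a \<otimes> inv a') \<otimes> b = inv a' \<otimes> (a \<otimes> b)" by (simp add: m_ac)
      also have "\<dots> = inv a' \<otimes> (a' \<otimes> b')" using b by simp
      also have "\<dots> = b'" by (simp flip: m_assoc)
      finally show "z \<in> (\<lambda>b. a \<otimes> b) ` ?C" using b by auto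
    qed
    then have "card (?X \<inter> ?Y) \<le> card ((\<lambda>b. a \<otimes> b) ` ?C)"
      using fin by (intro card_mono) auto
    also have "\<dots> \<le> card ?C" using fin by (intro card_image_le) auto
    finally show ?thesis .
  qed
  then show ?thesis using union sum card unfolding XY by linarith
qed

text \<open>Freiman's 3/2 argument: if \<open>A B\<close> is small, then every quotient of two elements of \<open>A\<close> is a
  quotient of elements of \<open>B\<close> in more than \<open>n / 2\<close> ways and vice versa, so the quotients form a
  subgroup.\<close>

theorem small_product_set:
  assumes fin: "finite A" "finite B" and sub: "A \<subseteq> carrier G" "B \<subseteq> carrier G"
    and n: "card A = n" "card B = n" and card: "2 * card (A <#> B) < 3 * n"
  shows "\<exists>H. subgroup H G \<and> finite H \<and> card H \<le> card (A <#> B) \<and>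
           (\<exists>K\<in>rcosets H. A \<subseteq> K) \<and> (\<exists>K\<in>rcosets H. B \<subseteq> K)"
proof -
  define Q where "Q S = (\<lambda>(x, y). x \<otimes> inv y) ` (S \<times> S)" for S
  have "X <#> Y \<subseteq> Y <#> X" if "X \<subseteq> carrier G" "Y \<subseteq> carrier G" for X Y
  proof
    fix z assume "z \<in> X <#> Y"
    then obtain x y where xy: "x \<in> X" "y \<in> Y" "z = x \<otimes> y" by (auto simp: set_mult_def)
    then have "z = y \<otimes> x" using that m_comm[of x y] by blast
    then show "z \<in> Y <#> X" using xy unfolding set_mult_def by blast
  qed
  \<comment> \<open>Commutativity lets the overlap bound be used with the roles of \<open>A\<close>
    and \<open>B\<close> exchanged.\<close>
  then have comm: "A <#> B = B <#> A" using sub by blast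
  have QI: "x \<otimes> inv y \<in> Q S" if "x \<in> S" "y \<in> S" for x y S using that by (auto simp: Q_def)
  have Q_translate: "d \<in> Q S" if "d \<in> carrier G" "S \<subseteq> carrier G" "y \<in> S" "d \<otimes> y \<in> S" for d S y
  proof -
    have "d = (d \<otimes> y) \<otimes> inv y" using that by (auto simp: m_assoc)
    then show ?thesis using QI[OF that(4,3)] by simp
  qed
  have carr: "Q S \<subseteq> carrier G" if "S \<subseteq> carrier G" for S using that by (auto simp: Q_def)
  have QA: "n < 2 * card {b \<in> B. d \<otimes> b \<in> B}" if d: "d \<in> Q A" for d
    using d card_diff_translate[OF fin sub] card n by (auto simp: Q_def)
  have QB: "n < 2 * card {b \<in> A. d \<otimes> b \<in> A}" if d: "d \<in> Q B" for d
    using d card_diff_translate[OF fin(2,1) sub(2,1)] card n comm by (auto simp: Q_def)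
  have eq: "Q A = Q B"
  proof
    show "Q A \<subseteq> Q B"
    proof
      fix d assume d: "d \<in> Q A"
      then have "{b \<in> B. d \<otimes> b \<in> B} \<noteq> {}" using QA[OF d] by (intro notI) simp
      then show "d \<in> Q B" using Q_translate d carr sub by blast
    qed
    show "Q B \<subseteq> Q A"
    proof
      fix d assume d: "d \<in> Q B"
      then have "{b \<in> A. d \<otimes> b \<in> A} \<noteq> {}" using QB[OF d] by (intro notI) simp
      then show "d \<in> Q A" using Q_translate d carr sub by blast
    qed
  qed
  define H where "H = Q B"
  have n0: "n > 0" using card by linarith
  then obtain a0 b0 where ab: "a0 \<in> A" "b0 \<in> B" using n by (metis card_gt_0_iff ex_in_conv)
  have ab_carr [simp]: "a0 \<in> carrier G" "b0 \<in> carrier G" using ab sub by auto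
  have Hc: "H \<subseteq> carrier G" unfolding H_def by (rule carr) (rule sub)
  have reps: "n < 2 * card {b \<in> B. d \<otimes> b \<in> B}" if "d \<in> H" for d
    using QA that eq by (simp add: H_def)
  have inv_H: "inv d \<in> H" if d: "d \<in> H" for d
  proof -
    obtain x y where "x \<in> B" "y \<in> B" "d = x \<otimes> inv y" using d by (auto simp: H_def Q_def)
    moreover from this have "x \<in> carrier G" "y \<in> carrier G" using sub by auto
    ultimately have "x \<in> B" "y \<in> B" "inv d = y \<otimes> inv x"
      by (simp_all add: inv_mult_group)
    then show ?thesis by (simp add: H_def QI)
  qed
  have mult_H: "d \<otimes> e \<in> H" if d: "d \<in> H" and e: "e \<in> H" for d e
  proof -
    \<comment> \<open>Each set contains more than half of \<open>B\<close>, so they share some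
      \<open>b\<close>; the quotient of \<open>d \<otimes> b\<close> by
      \<open>inv e \<otimes> b\<close> is \<open>d \<otimes> e\<close>.\<close>
    let ?C = "{b \<in> B. d \<otimes> b \<in> B}" and ?D = "{b \<in> B. inv e \<otimes> b \<in> B}"
    have "card (?C \<union> ?D) \<le> n" using card_mono[of B "?C \<union> ?D"] fin n by auto
    moreover have "card (?C \<union> ?D) + card (?C \<inter> ?D) = card ?C + card ?D"
      using fin by (intro card_Un_Int[symmetric]) auto
    ultimately have "card (?C \<inter> ?D) > 0" using reps[OF d] reps[OF inv_H[OF e]] by linarith
    then have "?C \<inter> ?D \<noteq> {}" by (intro notI) simp
    then obtain b where b: "b \<in> B" "d \<otimes> b \<in> B" "inv e \<otimes> b \<in> B" by blast
    have [simp]: "d \<in> carrier G" "e \<in> carrier G" "b \<in> carrier G" using d e b Hc sub by auto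
    have "(d \<otimes> b) \<otimes> inv (inv e \<otimes> b) = (d \<otimes> e) \<otimes> (b \<otimes> inv b)"
      by (simp add: inv_mult_group m_ac del: r_inv Units_r_inv)
    then have "(d \<otimes> b) \<otimes> inv (inv e \<otimes> b) = d \<otimes> e" by simp
    then show ?thesis using QI[OF b(2,3)] by (simp add: H_def)
  qed
  have sg: "subgroup H G"
  proof (rule subgroupI[OF Hc])
    show "H \<noteq> {}" using QI[OF ab(2,2)] by (auto simp: H_def)
  qed (use inv_H mult_H in auto)
  have finH: "finite H" using fin by (simp add: H_def Q_def)
  have HA: "a \<otimes> inv a0 \<in> H" if "a \<in> A" for a
    using QI[OF that ab(1)] eq by (simp add: H_def)
  have HB: "b \<otimes> inv b0 \<in> H" if "b \<in> B" for b
    using QI[OF that ab(2)] by (simp add: H_def)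
  \<comment> \<open>Double counting of \<open>B \<times> B\<close> by quotients: each element of
    \<open>H\<close> accounts for more than \<open>n / 2\<close> of the \<open>n * n\<close>
    pairs.\<close>
  have "card H * n < 2 * (n * n)"
  proof -
    have "card (SIGMA d:H. {b \<in> B. d \<otimes> b \<in> B}) \<le> card (B \<times> B)"
    proof (rule card_inj_on_le[where f = "\<lambda>(d, b). (d \<otimes> b, b)"])
      show "inj_on (\<lambda>(d, b). (d \<otimes> b, b)) (SIGMA d:H. {b \<in> B. d \<otimes> b \<in> B})"
        using Hc sub by (auto intro!: inj_onI simp: subset_iff)
    qed (use fin in auto)
    then have le: "(\<Sum>d\<in>H. card {b \<in> B. d \<otimes> b \<in> B}) \<le> n * n"
      using fin finH n by (simp add: card_cartesian_product)
    have "H \<noteq> {}" using sg subgroup.one_closed by auto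
    then have "(\<Sum>d\<in>H. n) < (\<Sum>d\<in>H. 2 * card {b \<in> B. d \<otimes> b \<in> B})"
      using finH reps by (intro sum_strict_mono) auto
    also have "\<dots> \<le> 2 * (n * n)" using le by (simp flip: sum_distrib_left)
    finally show ?thesis by simp
  qed
  then have "card H * n < (2 * n) * n" by simp
  then have H2n: "card H < 2 * n" by (simp only: mult_less_cancel2)
  \<comment> \<open>As \<open>card H < 2 * n\<close>, the \<open>n\<close>-element subsets
    \<open>?X\<close> and \<open>?Y\<close> of \<open>H\<close> meet, which writes \<open>h\<close>
    as an element of \<open>A <#> B\<close> up to a fixed factor. So a translate of \<open>H\<close>
    lies in \<open>A <#> B\<close>, which bounds \<open>card H\<close>.\<close>
  have "H \<subseteq> (\<lambda>z. z \<otimes> inv (a0 \<otimes> b0)) ` (A <#> B)"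
  proof
    fix h assume h: "h \<in> H"
    let ?X = "(\<lambda>a. h \<otimes> inv (a \<otimes> inv a0)) ` A" and ?Y = "(\<lambda>b. b \<otimes> inv b0) ` B"
    have hc: "h \<in> carrier G" using h Hc by auto
    have "?X \<union> ?Y \<subseteq> H" using h HA HB inv_H mult_H by auto
    then have "card (?X \<union> ?Y) \<le> card H" using finH by (intro card_mono)
    moreover have "card ?X = n"
    proof -
      have "inj_on (\<lambda>a. h \<otimes> inv (a \<otimes> inv a0)) A"
      proof (rule inj_onI)
        fix a a' assume a: "a \<in> A" "a' \<in> A"
          and eq: "h \<otimes> inv (a \<otimes> inv a0) = h \<otimes> inv (a' \<otimes> inv a0)"
        then have [simp]: "a \<in> carrier G" "a' \<in> carrier G" using sub by auto
        have "inv (a \<otimes> inv a0) = inv (a' \<otimes> inv a0)" using eq hc by simp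
        then have "inv (inv (a \<otimes> inv a0)) = inv (inv (a' \<otimes> inv a0))" by simp
        then show "a = a'" by (simp del: inv_mult_group)
      qed
      then show ?thesis by (simp add: card_image n)
    qed
    moreover have "card ?Y = n"
    proof -
      have "inj_on (\<lambda>b. b \<otimes> inv b0) B"
        using sub(2) by (auto intro: inj_on_subset[OF inj_on_multc])
      then show ?thesis by (simp add: card_image n)
    qed
    moreover have "card (?X \<union> ?Y) + card (?X \<inter> ?Y) = card ?X + card ?Y"
      using fin by (intro card_Un_Int[symmetric]) auto
    ultimately have "card (?X \<inter> ?Y) > 0" using H2n by linarith
    then have "?X \<inter> ?Y \<noteq> {}" by (intro notI) simp
    then obtain a b where xy: "a \<in> A" "b \<in> B" "h \<otimes> inv (a \<otimes> inv a0) = b \<otimes> inv b0" by auto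
    have [simp]: "a \<in> carrier G" "b \<in> carrier G" using xy sub by auto
    have "h = (h \<otimes> inv (a \<otimes> inv a0)) \<otimes> (a \<otimes> inv a0)"
      using hc by (simp add: m_assoc del: inv_mult_group)
    also have "\<dots> = (b \<otimes> inv b0) \<otimes> (a \<otimes> inv a0)" using xy by simp
    also have "\<dots> = (a \<otimes> b) \<otimes> (inv a0 \<otimes> inv b0)" by (simp add: m_ac)
    also have "inv a0 \<otimes> inv b0 = inv (a0 \<otimes> b0)" by (simp add: inv_mult)
    finally show "h \<in> (\<lambda>z. z \<otimes> inv (a0 \<otimes> b0)) ` (A <#> B)"
      using xy by (auto simp: set_mult_def)
  qed
  moreover have fAB: "finite (A <#> B)" using fin by (simp add: set_mult_def)
  ultimately have "card H \<le> card ((\<lambda>z. z \<otimes> inv (a0 \<otimes> b0)) ` (A <#> B))"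
    by (intro card_mono) auto
  also have "\<dots> \<le> card (A <#> B)" by (rule card_image_le[OF fAB])
  finally have "card H \<le> card (A <#> B)" .
  moreover have "A \<subseteq> H #> a0"
  proof
    fix a assume a: "a \<in> A"
    then have "a = (a \<otimes> inv a0) \<otimes> a0" using sub by (auto simp: m_assoc)
    then show "a \<in> H #> a0" using HA[OF a] by (auto simp: r_coset_def)
  qed
  moreover have "B \<subseteq> H #> b0"
  proof
    fix b assume b: "b \<in> B"
    then have "b = (b \<otimes> inv b0) \<otimes> b0" using sub by (auto simp: m_assoc)
    then show "b \<in> H #> b0" using HB[OF b] by (auto simp: r_coset_def)
  qed
  moreover have "H #> a0 \<in> rcosets H" "H #> b0 \<in> rcosets H"
    using Hc by (auto intro: rcosetsI)
  ultimately show ?thesis using sg finH by blast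
qed

end

theorem theorem1p10:
  fixes B G R :: "proj_point set" and n :: nat and F :: poly3 and e :: proj_point
  assumes "finite B" and "finite G" and "finite R"
    and "B \<inter> G = {}" and "B \<inter> R = {}" and "G \<inter> R = {}"
    and "general_position (B \<union> G)"
    and "\<And>b g l. b \<in> B \<Longrightarrow> g \<in> G \<Longrightarrow> on_line b l \<Longrightarrow> on_line g l \<Longrightarrow> \<exists>r\<in>R. on_line r l"
    and "card B = n" and "card G = n"
    and "real (card R) < 3 / 2 * real n"
    and "irreducible_cubic F"
    and "B \<union> G \<union> R \<subseteq> curve_points F"
    and "inflection_point F e"
  shows "\<exists>H. subgroup H (cubic_group F e) \<and> finite H \<and> card H \<le> card R \<and>
           (\<exists>K \<in> rcosets\<^bsub>cubic_group F e\<^esub> H. B \<subseteq> K) \<and>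
           (\<exists>K \<in> rcosets\<^bsub>cubic_group F e\<^esub> H. G \<subseteq> K)"
proof -
  let ?C = "cubic_group F e"
  obtain a2 a4 a6 p q r k where "weierstrass_cubic a2 a4 a6 F e p q r k"
    using exists_weierstrass_cubic assms(12,14) by blast
  then interpret weierstrass_cubic a2 a4 a6 F e p q r k .
  interpret C: comm_group ?C by (rule comm_group_cubic_group)
  have third: "b \<in> nonsingular_points F \<and> g \<in> nonsingular_points F \<and> third_point F b g \<in> R"
    if bg: "b \<in> B" "g \<in> G" for b g
  proof -
    obtain l where l: "on_line b l" "on_line g l" using proj_line_through by blast
    then obtain c where c: "c \<in> R" "on_line c l" using assms(8) bg by blast
    \<comment> \<open>Disjointness makes the three points of the line distinct, so \<open>c\<close>
      is the third point of \<open>b\<close> and \<open>g\<close>.\<close>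
    have "b \<noteq> g" "b \<noteq> c" "g \<noteq> c" using assms(4-6) bg c by auto
    then show ?thesis using collinear_third_point[OF l c(2)] bg c(1) assms(13) by auto
  qed
  \<comment> \<open>Each point of \<open>B\<close> or \<open>G\<close> needs a partner in the other
    set before \<open>third\<close> can show it nonsingular.\<close>
  have "n > 0" using assms(11) by (cases "n = 0") auto
  then have "B \<noteq> {}" "G \<noteq> {}" using assms(9,10) by auto
  then have sub: "B \<subseteq> carrier ?C" "G \<subseteq> carrier ?C" using third by (auto simp: cubic_group_def)
  \<comment> \<open>A sum is the negative of a third point, so the product set lies in the image of
    \<open>R\<close> under \<open>third_point F e\<close>.\<close>
  have "B <#>\<^bsub>?C\<^esub> G \<subseteq> third_point F e ` R"
    using third by (auto simp: set_mult_def cubic_group_def)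
  then have "card (B <#>\<^bsub>?C\<^esub> G) \<le> card (third_point F e ` R)"
    using assms(3) by (intro card_mono) auto
  also have "\<dots> \<le> card R" using assms(3) by (rule card_image_le)
  finally have le: "card (B <#>\<^bsub>?C\<^esub> G) \<le> card R" .
  moreover have "2 * card R < 3 * n" using assms(11) by linarith
  ultimately have "2 * card (B <#>\<^bsub>?C\<^esub> G) < 3 * n" by linarith
  from C.small_product_set[OF assms(1,2) sub assms(9,10) this] show ?thesis
    using le by (meson le_trans)
qed

end
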